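(* Let $p\in(0,1)$ and let $q\ge1$ be a natural number. For all integers $L,d\ge2$, the single-bond dynamics $P_{\rm SB}$ for the random-cluster model on the torus $T_{L,d}$ with parameters $p$ and $q$ satisfies $$\tau(P_{\rm SB})\;\le\;\exp\bigl\{k_1(p)+k_2(q)\,L^{d-1}\bigr\},$$ where $$k_1(p)=\log\left(1+\log\frac1{p(1-p)}\right)\qquad\text{and}\qquad k_2(q)=4+3\log q+\log(1+\log q),$$ and $\tau$ denotes the mixing time.
   Context: $T_{L,d}$ is the $d$-dimensional discrete torus of side length $L$: the graph with vertex set $(\mathbb Z/L\mathbb Z)^d$, in which two distinct vertices are adjacent iff they differ in exactly one coordinate and there by $\pm1$ modulo $L$. For a finite graph $G=(V,E)$, the random-cluster model with parameters $p,q$ has state space $\Omega_{\rm RC}=\{A:A\subseteq E\}$ and probability measure $\mu(A)=\frac1Z\left(\frac p{1-p}\right)^{|A|}q^{c(A)}$, where $c(A)$ is the number of connected components of $(V,A)$ (isolated vertices count as components) and $Z$ is the normalizing constant. Single-bond dynamics (on $\Omega_{\rm RC}$): $P_{\rm SB}(A,B)=\frac12\mathbf 1(A=B)+\frac1{2|E|}\sum_{e\in E}P_e(A,B)$, where for $e=\{e_1,e_2\}$, $P_e(A,B)=0$ unless the symmetric difference of $A$ and $B$ is contained in $\{e\}$, in which case $P_e(A,B)=p^{|B\cap\{e\}|}(1-p)^{1-|B\cap\{e\}|}$ if $e_1,e_2$ are connected in $(V,A)$, and $P_e(A,B)=\left(\frac pq\right)^{|B\cap\{e\}|}\left(1-\frac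 pq\right)^{1-|B\cap\{e\}|}$ if they are not connected in $(V,A)$. It is ergodic with stationary distribution $\mu$. The mixing time of an ergodic transition matrix $P$ on a finite set $\Omega$ with stationary distribution $\pi$ is $\tau(P)=\min\{t:\max_{x\in\Omega}\sum_{y\in\Omega}|P^t(x,y)-\pi(y)|\le \frac1e\}$. *)

theory Defs
  imports Complex_Main "HOL-Library.FuncSet"
begin

section \<open>Finite simple graphs\<close>

text \<open>
  A graph is given by its vertex set and a set of edges, each edge being a two-element set of
  vertices. A spanning subgraph is determined by its edge set alone.
\<close>

definition adj_rel :: "'v set set \<Rightarrow> ('v \<times> 'v) set" where
  "adj_rel A = {(u, v). {u, v} \<in> A}"

definition conn_rel :: "'v set \<Rightarrow> 'v set set \<Rightarrow> ('v \<times> 'v) set" where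
  "conn_rel V A = {(u, v). u \<in> V \<and> v \<in> V \<and> (u, v) \<in> (adj_rel A)\<^sup>*}"

definition num_components :: "'v set \<Rightarrow> 'v set set \<Rightarrow> nat" where
  "num_components V A = card (V // conn_rel V A)"


section \<open>The discrete torus\<close>

text \<open>
  Points of \<open>(\<int>/L\<int>)\<^sup>d\<close> are represented by their coordinate functions with values in
  \<open>{0, \<dots>, L - 1}\<close>, which are \<open>undefined\<close> outside \<open>{..<d}\<close>. For \<open>L = 2\<close> the two neighbours
  in a given direction coincide, so that the graph stays simple.
\<close>

definition torus_verts :: "nat \<Rightarrow> nat \<Rightarrow> (nat \<Rightarrow> nat) set" where
  "torus_verts L d = ({..<d} \<rightarrow>\<^sub>E {..<L})"

definition torus_adj :: "nat \<Rightarrow> nat \<Rightarrow> (nat \<Rightarrow> nat) \<Rightarrow> (nat \<Rightarrow> nat) \<Rightarrow> bool" where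
  "torus_adj L d x y \<longleftrightarrow>
     (\<exists>i<d. x i \<noteq> y i \<and> (y i = (x i + 1) mod L \<or> x i = (y i + 1) mod L) \<and>
            (\<forall>j<d. j \<noteq> i \<longrightarrow> x j = y j))"

definition torus_edges :: "nat \<Rightarrow> nat \<Rightarrow> (nat \<Rightarrow> nat) set set" where
  "torus_edges L d =
     {{x, y} | x y. x \<in> torus_verts L d \<and> y \<in> torus_verts L d \<and> torus_adj L d x y}"


section \<open>The random-cluster model and its single-bond dynamics\<close>

definition rc_weight :: "'v set \<Rightarrow> real \<Rightarrow> nat \<Rightarrow> 'v set set \<Rightarrow> real" where
  "rc_weight V p q A = (p / (1 - p)) ^ card A * real q ^ num_components V A"

definition rc_partition :: "'v set \<Rightarrow> 'v set set \<Rightarrow> real \<Rightarrow> nat \<Rightarrow> real" where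
  "rc_partition V E p q = (\<Sum>A\<in>Pow E. rc_weight V p q A)"

definition rc_measure :: "'v set \<Rightarrow> 'v set set \<Rightarrow> real \<Rightarrow> nat \<Rightarrow> 'v set set \<Rightarrow> real" where
  "rc_measure V E p q A = rc_weight V p q A / rc_partition V E p q"

definition ends_connected :: "'v set \<Rightarrow> 'v set set \<Rightarrow> 'v set \<Rightarrow> bool" where
  "ends_connected V A e \<longleftrightarrow> (\<exists>u v. e = {u, v} \<and> (u, v) \<in> conn_rel V A)"

definition bond_update ::
  "'v set \<Rightarrow> real \<Rightarrow> nat \<Rightarrow> 'v set \<Rightarrow> 'v set set \<Rightarrow> 'v set set \<Rightarrow> real" where
  "bond_update V p q e A B =
     (if \<not> (A - B) \<union> (B - A) \<subseteq> {e} then 0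
      else if ends_connected V A e
      then p ^ card (B \<inter> {e}) * (1 - p) ^ (1 - card (B \<inter> {e}))
      else (p / real q) ^ card (B \<inter> {e}) * (1 - p / real q) ^ (1 - card (B \<inter> {e})))"

definition single_bond ::
  "'v set \<Rightarrow> 'v set set \<Rightarrow> real \<Rightarrow> nat \<Rightarrow> 'v set set \<Rightarrow> 'v set set \<Rightarrow> real" where
  "single_bond V E p q A B =
     1 / 2 * (if A = B then 1 else 0)
     + 1 / (2 * real (card E)) * (\<Sum>e\<in>E. bond_update V p q e A B)"


section \<open>Mixing times\<close>

primrec kernel_pow :: "'s set \<Rightarrow> ('s \<Rightarrow> 's \<Rightarrow> real) \<Rightarrow> nat \<Rightarrow> 's \<Rightarrow> 's \<Rightarrow> real" where
  "kernel_pow S P 0 x y = (if x = y then 1 else 0)"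
| "kernel_pow S P (Suc t) x y = (\<Sum>z\<in>S. P x z * kernel_pow S P t z y)"

text \<open>
  The distance is the full \<open>\<ell>\<^sub>1\<close>-distance, that is, twice the total variation distance. If no
  \<open>t\<close> satisfied the condition (which is impossible for an ergodic \<open>P\<close> with stationary
  distribution \<open>\<pi>\<close>), the value would be unspecified rather than \<open>0\<close>.
\<close>

definition mixing_time :: "'s set \<Rightarrow> ('s \<Rightarrow> 's \<Rightarrow> real) \<Rightarrow> ('s \<Rightarrow> real) \<Rightarrow> nat" where
  "mixing_time S P \<pi> =
     (LEAST t. Max ((\<lambda>x. \<Sum>y\<in>S. \<bar>kernel_pow S P t x y - \<pi> y\<bar>) ` S) \<le> 1 / exp 1)"


section \<open>The constants of the bound\<close>

definition k1 :: "real \<Rightarrow> real" where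
  "k1 p = ln (1 + ln (1 / (p * (1 - p))))"

definition k2 :: "nat \<Rightarrow> real" where
  "k2 q = 4 + 3 * ln (real q) + ln (1 + ln (real q))"

end

theory Submission
  imports Defs
begin

text \<open>
  The mixing time is bounded through the spectral gap, and the gap through canonical paths. For a
  lazy reversible chain, a Poincare inequality \<open>\<gamma> Var(f) \<le> \<E>(f, f)\<close> makes the variance of the
  density of the law at time \<open>t\<close> decay like \<open>exp (- \<gamma> t)\<close>, so that
  \<open>t \<ge> (2 + log (1 / min \<mu>)) / \<gamma>\<close> steps suffice for distance \<open>1 / e\<close> (\<open>mixing_time_le\<close>).

  For the single-bond dynamics on a graph with \<open>m\<close> edges, the path from \<open>A\<close> to \<open>B\<close> adjusts the edges
  one after the other in a fixed order. Each of its configurations is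
  \<open>X = (B \<inter> F) \<union> (A - F)\<close> for an initial segment \<open>F\<close> of that order, and \<open>(A, B)\<close> is recovered from \<open>X\<close>
  together with the complementary configuration \<open>Y = (A \<inter> F) \<union> (B - F)\<close>. As \<open>|X| + |Y| = |A| + |B|\<close>, the
  products \<open>\<mu>(A) \<mu>(B)\<close> and \<open>\<mu>(X) \<mu>(Y)\<close> differ only by the power of \<open>q\<close> that counts components. If \<open>s\<close>
  vertices separate \<open>F\<close> from the other edges, then the numbers of components satisfy
  \<open>c(A) + c(B) \<le> c(X) + c(Y) + s - 1\<close>. This is shown by counting colourings of the vertices with
  values in \<open>\<int>/q\<int>\<close> that are constant on components, of which there are \<open>q\<close> to the number of
  components: a pair of colourings of \<open>A\<close> and \<open>B\<close> that agree on the separating set can be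
  exchanged across it to give colourings of \<open>X\<close> and \<open>Y\<close> (\<open>card_colourings_exchange\<close>). Summing over
  the paths through a given transition gives the Poincare inequality with
  \<open>\<gamma> = 1 / (2 m\<^sup>2 q\<^sup>s)\<close> (\<open>poincare_single_bond\<close>). The bound \<open>\<mu>(e closed) \<le> (1 - p) q\<close> removes the dependence
  on \<open>p\<close>.

  The edges of the torus are ordered layer by layer in one coordinate direction. Then three layers
  always separate, namely the layer that is being processed, the one before it, and the bottom
  layer, because of the edges that wrap around; hence \<open>s = 3 L\<^bsup>d - 1\<^esup>\<close> (\<open>torus_edge_order\<close>). Together
  with \<open>m \<le> 2 n\<^sup>2\<close> and \<open>L\<^sup>d \<le> n\<^sup>2\<close> for \<open>n = L\<^bsup>d - 1\<^esup>\<close>, the polynomial factors are absorbed by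
  \<open>exp (4 n)\<close>.
\<close>

section \<open>Mixing of lazy reversible chains\<close>

lemma weighted_jensen_square:
  fixes w f :: "'a \<Rightarrow> real"
  assumes "\<And>y. y \<in> S \<Longrightarrow> 0 \<le> w y" and "sum w S = 1"
  shows "(\<Sum>y\<in>S. w y * f y)\<^sup>2 \<le> (\<Sum>y\<in>S. w y * (f y)\<^sup>2)"
proof -
  define m where "m = (\<Sum>y\<in>S. w y * f y)"
  have "0 \<le> (\<Sum>y\<in>S. w y * (f y - m)\<^sup>2)"
    using assms(1) by (intro sum_nonneg mult_nonneg_nonneg) auto
  also have "\<dots> = (\<Sum>y\<in>S. w y * (f y)\<^sup>2 - 2 * m * (w y * f y) + m\<^sup>2 * w y)"
    by (intro sum.cong refl) (simp add: power2_eq_square algebra_simps)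
  also have "\<dots> = (\<Sum>y\<in>S. w y * (f y)\<^sup>2) - 2 * m * m + m\<^sup>2 * 1"
    using assms(2) by (simp add: sum.distrib sum_subtractf flip: sum_distrib_left m_def)
  finally show ?thesis by (simp add: m_def power2_eq_square)
qed

text \<open>
  A Markov chain on the finite set \<open>S\<close> with transition matrix \<open>P\<close> that is reversible with respect
  to the positive probability weights \<open>\<pi>\<close> and stays put with probability at least one half.
\<close>

locale lazy_reversible_chain =
  fixes S :: "'s set" and P :: "'s \<Rightarrow> 's \<Rightarrow> real" and \<pi> :: "'s \<Rightarrow> real"
  assumes finite_states: "finite S"
    and kernel_nonneg: "\<lbrakk>x \<in> S; y \<in> S\<rbrakk> \<Longrightarrow> 0 \<le> P x y"
    and kernel_sum: "x \<in> S \<Longrightarrow> (\<Sum>y\<in>S. P x y) = 1"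
    and lazy: "x \<in> S \<Longrightarrow> 1 / 2 \<le> P x x"
    and pi_pos: "x \<in> S \<Longrightarrow> 0 < \<pi> x"
    and pi_sum: "(\<Sum>x\<in>S. \<pi> x) = 1"
    and detailed_balance: "\<lbrakk>x \<in> S; y \<in> S\<rbrakk> \<Longrightarrow> \<pi> x * P x y = \<pi> y * P y x"
begin

text \<open>The action \<open>f \<mapsto> P f\<close> of the transition matrix on functions.\<close>

definition apply_kernel :: "('s \<Rightarrow> real) \<Rightarrow> 's \<Rightarrow> real" where
  "apply_kernel f x = (\<Sum>y\<in>S. P x y * f y)"

text \<open>
  The Dirichlet form and the variance, both as sums over ordered pairs. The factor \<open>1 / 2\<close> makes
  the second one the usual variance with respect to \<open>\<pi>\<close>.
\<close>

definition dirichlet :: "('s \<Rightarrow> real) \<Rightarrow> real" where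
  "dirichlet f = 1 / 2 * (\<Sum>x\<in>S. \<Sum>y\<in>S. \<pi> x * P x y * (f x - f y)\<^sup>2)"

definition variance :: "('s \<Rightarrow> real) \<Rightarrow> real" where
  "variance f = 1 / 2 * (\<Sum>x\<in>S. \<Sum>y\<in>S. \<pi> x * \<pi> y * (f x - f y)\<^sup>2)"

lemma stationary:
  assumes "y \<in> S"
  shows "(\<Sum>x\<in>S. \<pi> x * P x y) = \<pi> y"
proof -
  have "(\<Sum>x\<in>S. \<pi> x * P x y) = (\<Sum>x\<in>S. \<pi> y * P y x)"
    by (intro sum.cong refl detailed_balance assms)
  then show ?thesis using kernel_sum[OF assms] by (simp flip: sum_distrib_left)
qed

lemma sum_apply_kernel: "(\<Sum>x\<in>S. \<pi> x * apply_kernel f x) = (\<Sum>x\<in>S. \<pi> x * f x)"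
proof -
  have "(\<Sum>x\<in>S. \<pi> x * apply_kernel f x) = (\<Sum>x\<in>S. \<Sum>y\<in>S. (\<pi> x * P x y) * f y)"
    by (simp add: apply_kernel_def sum_distrib_left mult.assoc)
  also have "\<dots> = (\<Sum>y\<in>S. \<Sum>x\<in>S. (\<pi> x * P x y) * f y)"
    by (rule sum.swap)
  also have "\<dots> = (\<Sum>y\<in>S. \<pi> y * f y)"
    by (intro sum.cong refl) (simp add: stationary flip: sum_distrib_right)
  finally show ?thesis .
qed

lemma dirichlet_eq:
  "dirichlet f = (\<Sum>x\<in>S. \<pi> x * (f x)\<^sup>2) - (\<Sum>x\<in>S. \<pi> x * (f x * apply_kernel f x))"
proof -
  have "(\<Sum>x\<in>S. \<Sum>y\<in>S. \<pi> x * P x y * (f x - f y)\<^sup>2)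
      = (\<Sum>x\<in>S. \<pi> x * (f x)\<^sup>2 + \<pi> x * apply_kernel (\<lambda>y. (f y)\<^sup>2) x
            - 2 * (\<pi> x * (f x * apply_kernel f x)))"
  proof (intro sum.cong refl)
    fix x assume x: "x \<in> S"
    have "(\<Sum>y\<in>S. \<pi> x * P x y * (f x - f y)\<^sup>2)
        = (\<Sum>y\<in>S. \<pi> x * (f x)\<^sup>2 * P x y + \<pi> x * (P x y * (f y)\<^sup>2) - 2 * \<pi> x * f x * (P x y * f y))"
      by (intro sum.cong refl) (simp add: power2_eq_square algebra_simps)
    then show "(\<Sum>y\<in>S. \<pi> x * P x y * (f x - f y)\<^sup>2)
        = \<pi> x * (f x)\<^sup>2 + \<pi> x * apply_kernel (\<lambda>y. (f y)\<^sup>2) x - 2 * (\<pi> x * (f x * apply_kernel f x))"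
      using kernel_sum[OF x]
      by (simp add: sum.distrib sum_subtractf apply_kernel_def flip: sum_distrib_left)
  qed
  then show ?thesis
    by (simp add: dirichlet_def sum.distrib sum_subtractf sum_apply_kernel flip: sum_distrib_left)
qed

text \<open>
  Laziness makes \<open>P\<close> a positive contraction, so that \<open>P\<^sup>2 \<le> P\<close> as quadratic forms. The proof
  applies Jensen's inequality to the kernel \<open>2 P - I\<close>, which is again stochastic and has the
  same stationary distribution.
\<close>

lemma sum_apply_kernel_square_le:
  "(\<Sum>x\<in>S. \<pi> x * (apply_kernel f x)\<^sup>2) \<le> (\<Sum>x\<in>S. \<pi> x * (f x * apply_kernel f x))"
proof -
  have pointwise: "(2 * apply_kernel f x - f x)\<^sup>2 \<le> 2 * apply_kernel (\<lambda>y. (f y)\<^sup>2) x - (f x)\<^sup>2"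
    if x: "x \<in> S" for x
  proof -
    \<comment> \<open>\<open>K\<close> is the row at \<open>x\<close> of \<open>2 P - I\<close>; it is nonnegative by laziness.\<close>
    define K where "K y = 2 * P x y - (if x = y then 1 else 0)" for y
    have K_sum: "(\<Sum>y\<in>S. K y * g y) = 2 * apply_kernel g x - g x" for g
    proof -
      have "(\<Sum>y\<in>S. K y * g y) = (\<Sum>y\<in>S. 2 * (P x y * g y) - (if x = y then g y else 0))"
        by (intro sum.cong refl) (simp add: K_def algebra_simps)
      then show ?thesis
        using x finite_states by (simp add: apply_kernel_def sum_subtractf flip: sum_distrib_left)
    qed
    have "(\<Sum>y\<in>S. K y * f y)\<^sup>2 \<le> (\<Sum>y\<in>S. K y * (f y)\<^sup>2)"
    proof (rule weighted_jensen_square)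
      show "0 \<le> K y" if "y \<in> S" for y
        using kernel_nonneg[OF x that] lazy[OF x] by (auto simp: K_def)
      show "sum K S = 1"
        using K_sum[of "\<lambda>_. 1"] kernel_sum[OF x] by (simp add: apply_kernel_def)
    qed
    then show ?thesis by (simp add: K_sum)
  qed
  have "(\<Sum>x\<in>S. \<pi> x * (2 * apply_kernel f x - f x)\<^sup>2)
      \<le> (\<Sum>x\<in>S. \<pi> x * (2 * apply_kernel (\<lambda>y. (f y)\<^sup>2) x - (f x)\<^sup>2))"
    by (intro sum_mono mult_left_mono pointwise) (auto simp: pi_pos less_imp_le)
  also have "\<dots> = (\<Sum>x\<in>S. 2 * (\<pi> x * apply_kernel (\<lambda>y. (f y)\<^sup>2) x) - \<pi> x * (f x)\<^sup>2)"
    by (intro sum.cong refl) (simp add: algebra_simps)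
  also have "\<dots> = (\<Sum>x\<in>S. \<pi> x * (f x)\<^sup>2)"
    by (simp add: sum_subtractf sum_apply_kernel flip: sum_distrib_left)
  finally have "(\<Sum>x\<in>S. \<pi> x * (2 * apply_kernel f x - f x)\<^sup>2) \<le> (\<Sum>x\<in>S. \<pi> x * (f x)\<^sup>2)" .
  moreover have "(\<Sum>x\<in>S. \<pi> x * (2 * apply_kernel f x - f x)\<^sup>2)
      = (\<Sum>x\<in>S. 4 * (\<pi> x * (apply_kernel f x)\<^sup>2) - 4 * (\<pi> x * (f x * apply_kernel f x)) + \<pi> x * (f x)\<^sup>2)"
    by (intro sum.cong refl) (simp add: power2_eq_square algebra_simps)
  ultimately show ?thesis
    by (simp add: sum.distrib sum_subtractf flip: sum_distrib_left)
qed

lemma variance_centred: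
  assumes "(\<Sum>x\<in>S. \<pi> x * f x) = 0"
  shows "variance f = (\<Sum>x\<in>S. \<pi> x * (f x)\<^sup>2)"
proof -
  have "(\<Sum>y\<in>S. \<pi> x * \<pi> y * (f x - f y)\<^sup>2)
      = \<pi> x * (f x)\<^sup>2 + \<pi> x * (\<Sum>y\<in>S. \<pi> y * (f y)\<^sup>2)" for x
  proof -
    have "(\<Sum>y\<in>S. \<pi> x * \<pi> y * (f x - f y)\<^sup>2)
        = (\<Sum>y\<in>S. \<pi> x * (f x)\<^sup>2 * \<pi> y + \<pi> x * (\<pi> y * (f y)\<^sup>2) - 2 * \<pi> x * f x * (\<pi> y * f y))"
      by (intro sum.cong refl) (simp add: power2_eq_square algebra_simps)
    then show ?thesis
      by (simp add: sum.distrib sum_subtractf assms pi_sum flip: sum_distrib_left)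
  qed
  then show ?thesis
    by (simp add: variance_def sum.distrib pi_sum flip: sum_distrib_right)
qed

lemma kernel_pow_detailed_balance:
  assumes "x \<in> S" "y \<in> S"
  shows "\<pi> x * kernel_pow S P t x y = \<pi> y * kernel_pow S P t y x"
proof -
  have right_step: "kernel_pow S P (Suc t) x y = (\<Sum>z\<in>S. kernel_pow S P t x z * P z y)"
    if "x \<in> S" "y \<in> S" for x y t
    using that
  proof (induction t arbitrary: x)
    case 0
    then show ?case using finite_states by (simp add: if_distrib if_distribR cong: if_cong)
  next
    case (Suc t)
    have "kernel_pow S P (Suc (Suc t)) x y = (\<Sum>w\<in>S. P x w * kernel_pow S P (Suc t) w y)"
      by simp
    also have "\<dots> = (\<Sum>w\<in>S. P x w * (\<Sum>z\<in>S. kernel_pow S P t w z * P z y))"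
      by (intro sum.cong refl) (simp only: Suc.IH Suc.prems)
    also have "\<dots> = (\<Sum>w\<in>S. \<Sum>z\<in>S. P x w * kernel_pow S P t w z * P z y)"
      by (simp add: sum_distrib_left mult.assoc)
    also have "\<dots> = (\<Sum>z\<in>S. \<Sum>w\<in>S. P x w * kernel_pow S P t w z * P z y)"
      by (rule sum.swap)
    finally show ?case by (simp add: sum_distrib_right)
  qed
  show ?thesis using assms
  proof (induction t arbitrary: x y)
    case 0
    then show ?case by auto
  next
    case (Suc t)
    have "\<pi> x * kernel_pow S P (Suc t) x y = (\<Sum>z\<in>S. (\<pi> x * P x z) * kernel_pow S P t z y)"
      by (simp add: sum_distrib_left mult.assoc)
    also have "\<dots> = (\<Sum>z\<in>S. P z x * (\<pi> z * kernel_pow S P t z y))"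
      by (intro sum.cong refl) (simp add: detailed_balance[OF Suc.prems(1)])
    also have "\<dots> = (\<Sum>z\<in>S. P z x * (\<pi> y * kernel_pow S P t y z))"
      by (intro sum.cong refl) (simp only: Suc.IH Suc.prems)
    also have "\<dots> = \<pi> y * kernel_pow S P (Suc t) y x"
      using right_step[OF Suc.prems(2,1)] by (simp add: sum_distrib_left mult_ac del: kernel_pow.simps)
    finally show ?case .
  qed
qed

text \<open>
  A Poincare inequality with constant \<open>\<gamma>\<close> bounds the \<open>\<ell>\<^sub>1\<close>-distance to stationarity. The
  function \<open>y \<mapsto> P\<^sup>t(y, x) / \<pi>(x)\<close> is the density of \<open>P\<^sup>t(x, \<cdot>)\<close> with respect to \<open>\<pi>\<close>, by
  reversibility.
\<close>

lemma l1_distance_le: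
  assumes poincare: "\<And>f. \<gamma> * variance f \<le> dirichlet f"
    and x: "x \<in> S"
  shows "(\<Sum>y\<in>S. \<bar>kernel_pow S P t x y - \<pi> y\<bar>)\<^sup>2 \<le> exp (- \<gamma> * real t) / \<pi> x"
proof -
  \<comment> \<open>The density of the law at time \<open>t\<close> minus the constant \<open>1\<close>, a centred function.\<close>
  define g where "g t y = kernel_pow S P t y x / \<pi> x - 1" for t y
  have g_Suc: "g (Suc t) y = apply_kernel (g t) y" if "y \<in> S" for t y
    using kernel_sum[OF that]
    by (simp add: g_def apply_kernel_def right_diff_distrib sum_subtractf sum_divide_distrib)
  have centred: "(\<Sum>y\<in>S. \<pi> y * g t y) = 0" for t
  proof (induction t)
    case 0
    have "(\<Sum>y\<in>S. \<pi> y * g 0 y) = (\<Sum>y\<in>S. (if y = x then 1 else 0) - \<pi> y)"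
      using pi_pos[OF x] by (intro sum.cong refl) (auto simp: g_def algebra_simps)
    then show ?case using finite_states x by (simp add: sum_subtractf pi_sum)
  next
    case (Suc t)
    then show ?case by (simp add: g_Suc sum_apply_kernel)
  qed
  have decay: "(\<Sum>y\<in>S. \<pi> y * (g t y)\<^sup>2) \<le> exp (- \<gamma> * real t) * (1 / \<pi> x)" for t
  proof (induction t)
    case 0
    have "(\<Sum>y\<in>S. \<pi> y * (g 0 y)\<^sup>2) = (\<Sum>y\<in>S. (if y = x then 1 / \<pi> x - 2 else 0) + \<pi> y)"
      using pi_pos[OF x]
      by (intro sum.cong refl) (auto simp: g_def power2_eq_square field_simps)
    then show ?case using finite_states x by (simp add: sum.distrib pi_sum)
  next
    case (Suc t)
    have "(\<Sum>y\<in>S. \<pi> y * (g (Suc t) y)\<^sup>2) = (\<Sum>y\<in>S. \<pi> y * (apply_kernel (g t) y)\<^sup>2)"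
      by (simp add: g_Suc)
    also have "\<dots> \<le> (\<Sum>y\<in>S. \<pi> y * (g t y * apply_kernel (g t) y))"
      by (rule sum_apply_kernel_square_le)
    also have "\<dots> = (\<Sum>y\<in>S. \<pi> y * (g t y)\<^sup>2) - dirichlet (g t)"
      by (simp add: dirichlet_eq)
    also have "\<dots> \<le> (1 - \<gamma>) * (\<Sum>y\<in>S. \<pi> y * (g t y)\<^sup>2)"
      using poincare[of "g t"] by (simp add: variance_centred[OF centred] algebra_simps)
    also have "\<dots> \<le> exp (- \<gamma>) * (\<Sum>y\<in>S. \<pi> y * (g t y)\<^sup>2)"
      using exp_ge_add_one_self[of "- \<gamma>"]
      by (intro mult_right_mono sum_nonneg) (auto simp: pi_pos less_imp_le)
    also have "\<dots> \<le> exp (- \<gamma>) * (exp (- \<gamma> * real t) * (1 / \<pi> x))"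
      by (intro mult_left_mono Suc.IH) auto
    also have "\<dots> = exp (- \<gamma> * real (Suc t)) * (1 / \<pi> x)"
      by (simp add: algebra_simps flip: exp_add)
    finally show ?case .
  qed
  have "(\<Sum>y\<in>S. \<bar>kernel_pow S P t x y - \<pi> y\<bar>) = (\<Sum>y\<in>S. \<pi> y * \<bar>g t y\<bar>)"
  proof (intro sum.cong refl)
    fix y assume y: "y \<in> S"
    have "kernel_pow S P t x y - \<pi> y = \<pi> y * g t y"
      using kernel_pow_detailed_balance[OF x y, of t] pi_pos[OF x] by (simp add: g_def field_simps)
    then show "\<bar>kernel_pow S P t x y - \<pi> y\<bar> = \<pi> y * \<bar>g t y\<bar>"
      using pi_pos[OF y] by (simp add: abs_mult)
  qed
  moreover have "(\<Sum>y\<in>S. \<pi> y * \<bar>g t y\<bar>)\<^sup>2 \<le> (\<Sum>y\<in>S. \<pi> y * \<bar>g t y\<bar>\<^sup>2)"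
    by (rule weighted_jensen_square) (auto simp: pi_pos less_imp_le pi_sum)
  ultimately show ?thesis using decay[of t] by simp
qed

lemma mixing_time_le:
  assumes poincare: "\<And>f. \<gamma> * variance f \<le> dirichlet f"
    and t: "\<And>x. x \<in> S \<Longrightarrow> 2 + ln (1 / \<pi> x) \<le> \<gamma> * real t"
  shows "mixing_time S P \<pi> \<le> t"
  unfolding mixing_time_def
proof (rule Least_le)
  have "S \<noteq> {}" using pi_sum by auto
  moreover have "(\<Sum>y\<in>S. \<bar>kernel_pow S P t x y - \<pi> y\<bar>) \<le> 1 / exp 1" if x: "x \<in> S" for x
  proof (rule power2_le_imp_le)
    have "(\<Sum>y\<in>S. \<bar>kernel_pow S P t x y - \<pi> y\<bar>)\<^sup>2 \<le> exp (- \<gamma> * real t) * (1 / \<pi> x)"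
      using l1_distance_le[OF poincare x] by simp
    also have "\<dots> = exp (- \<gamma> * real t) * exp (ln (1 / \<pi> x))"
      using pi_pos[OF x] by simp
    also have "\<dots> = exp (ln (1 / \<pi> x) - \<gamma> * real t)"
      by (simp flip: exp_add)
    also have "\<dots> \<le> exp (- 2)"
      using t[OF x] by simp
    also have "\<dots> = (1 / exp 1)\<^sup>2"
      by (simp add: exp_minus power2_eq_square divide_simps flip: exp_add)
    finally show "(\<Sum>y\<in>S. \<bar>kernel_pow S P t x y - \<pi> y\<bar>)\<^sup>2 \<le> (1 / exp 1)\<^sup>2" .
  qed simp
  ultimately show "Max ((\<lambda>x. \<Sum>y\<in>S. \<bar>kernel_pow S P t x y - \<pi> y\<bar>) ` S) \<le> 1 / exp 1"
    using finite_states by simp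
qed

end


section \<open>Connected components and colourings\<close>

text \<open>
  A finite graph with vertex set \<open>V\<close> and edge set \<open>E\<close>. Loops, which are singletons \<open>{u}\<close>, are not
  excluded.
\<close>

locale finite_graph =
  fixes V :: "'v set" and E :: "'v set set"
  assumes finite_V: "finite V"
    and edgeE: "e \<in> E \<Longrightarrow> \<exists>u\<in>V. \<exists>v\<in>V. e = {u, v}"
begin

lemma edge_subset: "e \<in> E \<Longrightarrow> e \<subseteq> V"
  using edgeE by blast

lemma finite_E: "finite E"
  using edge_subset finite_V by (meson Pow_iff finite_Pow_iff finite_subset subsetI)

lemma equiv_conn_rel: "equiv V (conn_rel V A)"
proof (rule equivI)
  have "sym (adj_rel A)"
    by (auto simp: sym_def adj_rel_def insert_commute)
  then have "sym ((adj_rel A)\<^sup>*)" by (rule sym_rtrancl)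
  then show "sym (conn_rel V A)"
    by (auto simp: sym_def conn_rel_def)
qed (auto simp: conn_rel_def refl_on_def trans_def)

lemma finite_components: "finite (V // conn_rel V A)"
  using finite_V by (rule finite_quotient) (auto simp: conn_rel_def)

lemma num_components_le: "num_components V A \<le> card V"
  unfolding num_components_def quotient_def
  using card_image_le[OF finite_V, of "\<lambda>x. conn_rel V A `` {x}"] by (simp add: UNION_singleton_eq_range)

lemma conn_refl: "x \<in> V \<Longrightarrow> (x, x) \<in> conn_rel V A"
  by (auto simp: conn_rel_def)

lemma conn_sym: "(x, y) \<in> conn_rel V A \<Longrightarrow> (y, x) \<in> conn_rel V A"
  using equiv_conn_rel[of A] by (meson equivE symD)

lemma conn_trans: "(x, y) \<in> conn_rel V A \<Longrightarrow> (y, z) \<in> conn_rel V A \<Longrightarrow> (x, z) \<in> conn_rel V A"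
  using equiv_conn_rel[of A] by (meson equivE transD)

lemma conn_rel_insert:
  assumes "u \<in> V" "v \<in> V"
  shows "(x, y) \<in> conn_rel V (insert {u, v} A) \<longleftrightarrow>
    (x, y) \<in> conn_rel V A \<or>
    (x, u) \<in> conn_rel V A \<and> (v, y) \<in> conn_rel V A \<or>
    (x, v) \<in> conn_rel V A \<and> (u, y) \<in> conn_rel V A"
proof -
  have "adj_rel (insert {u, v} A) = insert (u, v) (insert (v, u) (adj_rel A))"
    by (auto simp: adj_rel_def doubleton_eq_iff)
  then show ?thesis
    using assms by (auto simp: conn_rel_def rtrancl_insert dest: rtrancl_trans)
qed

lemma num_components_insert_connected:
  assumes uv: "(u, v) \<in> conn_rel V A"
  shows "num_components V (insert {u, v} A) = num_components V A"
proof -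
  have V: "u \<in> V" "v \<in> V" using assms by (auto simp: conn_rel_def)
  have "(x, y) \<in> conn_rel V (insert {u, v} A) \<longleftrightarrow> (x, y) \<in> conn_rel V A" for x y
    unfolding conn_rel_insert[OF V] using uv conn_sym[OF uv] conn_trans[of _ _ A] by blast
  then have "conn_rel V (insert {u, v} A) = conn_rel V A" by auto
  then show ?thesis by (simp add: num_components_def)
qed

lemma num_components_insert_disconnected:
  assumes uv: "u \<in> V" "v \<in> V" and disconnected: "(u, v) \<notin> conn_rel V A"
  shows "num_components V A = Suc (num_components V (insert {u, v} A))"
proof -
  let ?R = "conn_rel V A" and ?R' = "conn_rel V (insert {u, v} A)"
  have eq: "equiv V ?R" "equiv V ?R'" by (rule equiv_conn_rel)+
  let ?U = "?R `` {u}" and ?W = "?R `` {v}"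
  have refl: "x \<in> V \<Longrightarrow> (x, x) \<in> ?R" for x by (rule conn_refl)
  have class_eq: "?R' `` {x} = (if x \<in> ?U \<union> ?W then ?U \<union> ?W else ?R `` {x})" if "x \<in> V" for x
  proof -
    have same: "(a, z) \<in> ?R \<longleftrightarrow> (b, z) \<in> ?R" if "(a, b) \<in> ?R" for a b z
      using conn_sym[OF that] that conn_trans by blast
    have "(x, y) \<in> ?R' \<longleftrightarrow> (if x \<in> ?U \<union> ?W then y \<in> ?U \<union> ?W else (x, y) \<in> ?R)" for y
    proof -
      consider "(u, x) \<in> ?R" | "(v, x) \<in> ?R" | "(u, x) \<notin> ?R" "(v, x) \<notin> ?R" by blast
      then show ?thesis
      proof cases
        case 1
        have "(x, u) \<in> ?R" using 1 by (rule conn_sym)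
        then show ?thesis
          unfolding conn_rel_insert[OF uv] same[OF 1, symmetric] using 1 by auto
      next
        case 2
        have "(x, v) \<in> ?R" using 2 by (rule conn_sym)
        then show ?thesis
          unfolding conn_rel_insert[OF uv] same[OF 2, symmetric] using 2 by auto
      next
        case 3
        then have "(x, u) \<notin> ?R" "(x, v) \<notin> ?R" using conn_sym by blast+
        then show ?thesis unfolding conn_rel_insert[OF uv] using 3 by simp
      qed
    qed
    then have "y \<in> ?R' `` {x} \<longleftrightarrow> y \<in> (if x \<in> ?U \<union> ?W then ?U \<union> ?W else ?R `` {x})" for y
      by (simp only: Image_singleton_iff) simp
    then show ?thesis by blast
  qed
  have U: "?U \<in> V // ?R" "?W \<in> V // ?R" using uv by (auto intro: quotientI)
  have UW: "?U \<noteq> ?W" using disconnected refl uv by auto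
  have "V // ?R' = insert (?U \<union> ?W) (V // ?R - {?U, ?W})"
  proof (intro equalityI subsetI)
    fix X assume "X \<in> V // ?R'"
    then obtain x where x: "x \<in> V" "X = ?R' `` {x}" by (auto elim: quotientE)
    show "X \<in> insert (?U \<union> ?W) (V // ?R - {?U, ?W})"
    proof (cases "x \<in> ?U \<union> ?W")
      case False
      then have "?R `` {x} \<noteq> ?U" "?R `` {x} \<noteq> ?W" using refl[OF x(1)] by auto
      then show ?thesis using False x by (auto simp: class_eq intro: quotientI)
    qed (use x class_eq in auto)
  next
    fix X assume X: "X \<in> insert (?U \<union> ?W) (V // ?R - {?U, ?W})"
    show "X \<in> V // ?R'"
    proof (cases "X = ?U \<union> ?W")
      case True
      then have "X = ?R' `` {u}" using class_eq[OF uv(1)] refl[OF uv(1)] by simp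
      then show ?thesis using uv by (auto intro: quotientI)
    next
      case False
      then obtain x where x: "x \<in> V" "X = ?R `` {x}" "X \<noteq> ?U" "X \<noteq> ?W"
        using X False by (metis DiffE insertCI insertE quotientE)
      then have "x \<notin> ?U \<union> ?W"
        using equiv_class_eq[OF eq(1), of u x] equiv_class_eq[OF eq(1), of v x] by auto
      then have "X = ?R' `` {x}" using class_eq[OF x(1)] x(2) by simp
      then show ?thesis using x by (auto intro: quotientI)
    qed
  qed
  moreover have "?U \<union> ?W \<notin> V // ?R - {?U, ?W}"
  proof
    assume "?U \<union> ?W \<in> V // ?R - {?U, ?W}"
    then have "?U \<union> ?W \<in> V // ?R" by simp
    moreover have "u \<in> ?U \<union> ?W" "v \<in> ?U \<union> ?W" using refl uv by auto
    ultimately have "(u, v) \<in> ?R" by (intro in_quotient_imp_in_rel[OF eq(1)]) auto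
    with disconnected show False by simp
  qed
  moreover have "card (V // ?R - {?U, ?W}) + 2 = card (V // ?R)"
  proof -
    have "card {?U, ?W} = 2" using UW by simp
    moreover have "card {?U, ?W} \<le> card (V // ?R)"
      using U by (intro card_mono finite_components) auto
    ultimately show ?thesis using U by (simp add: card_Diff_subset)
  qed
  ultimately show ?thesis
    by (simp add: num_components_def finite_components)
qed

text \<open>
  \<open>cut_bound F s\<close>: at most \<open>s\<close> vertices separate the edges in \<open>F\<close> from the other edges, in the
  sense that every vertex on an edge of both kinds belongs to the separating set \<open>T\<close>. The set
  \<open>T\<close> may be larger than necessary; that it is nonempty is what saves a factor \<open>q\<close> in
  \<open>card_colourings_exchange\<close>.
\<close>

definition cut_bound :: "'v set set \<Rightarrow> nat \<Rightarrow> bool" where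
  "cut_bound F s \<longleftrightarrow> (\<exists>T\<subseteq>V. T \<noteq> {} \<and> card T \<le> s \<and>
     (\<forall>f\<in>F \<inter> E. \<forall>e\<in>E - F. f \<inter> e \<subseteq> T))"

text \<open>
  Colourings of the vertices by residues modulo \<open>q\<close>, represented by \<open>{0..<q}\<close>, that are
  constant on the components of the spanning subgraph \<open>A\<close>.
\<close>

definition colourings :: "nat \<Rightarrow> 'v set set \<Rightarrow> ('v \<Rightarrow> int) set" where
  "colourings q A = {\<sigma> \<in> V \<rightarrow>\<^sub>E {0..<int q}. \<forall>(u, v)\<in>conn_rel V A. \<sigma> u = \<sigma> v}"

lemma colourings_iff:
  assumes "A \<subseteq> E"
  shows "\<sigma> \<in> colourings q A \<longleftrightarrow>
    \<sigma> \<in> V \<rightarrow>\<^sub>E {0..<int q} \<and> (\<forall>u v. {u, v} \<in> A \<longrightarrow> \<sigma> u = \<sigma> v)"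
proof -
  have "\<sigma> u = \<sigma> v" if "\<forall>u v. {u, v} \<in> A \<longrightarrow> \<sigma> u = \<sigma> v" "(u, v) \<in> conn_rel V A" for u v
  proof -
    from that(2) have "(u, v) \<in> (adj_rel A)\<^sup>*" by (simp add: conn_rel_def)
    then show ?thesis by (induction) (use that(1) in \<open>auto simp: adj_rel_def\<close>)
  qed
  moreover have "(u, v) \<in> conn_rel V A" if "{u, v} \<in> A" for u v
    using that assms edge_subset[of "{u, v}"] by (auto simp: conn_rel_def adj_rel_def)
  ultimately have "(\<forall>(u, v)\<in>conn_rel V A. \<sigma> u = \<sigma> v) \<longleftrightarrow> (\<forall>u v. {u, v} \<in> A \<longrightarrow> \<sigma> u = \<sigma> v)"
    by blast
  then show ?thesis by (simp add: colourings_def)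
qed

lemma finite_colourings: "finite (colourings q A)"
  by (rule finite_subset[of _ "V \<rightarrow>\<^sub>E {0..<int q}"])
     (auto simp: colourings_def finite_V intro: finite_PiE)

text \<open>
  A colouring that is constant on the components of \<open>A\<close> is a choice of one colour for each
  component. Hence powers of \<open>q\<close> with the number of components as exponent can be compared by
  counting colourings.
\<close>

lemma card_colourings: "card (colourings q A) = q ^ num_components V A"
proof -
  let ?R = "conn_rel V A"
  have eq: "equiv V ?R" by (rule equiv_conn_rel)
  have "bij_betw (\<lambda>g. \<lambda>v\<in>V. g (?R `` {v})) ((V // ?R) \<rightarrow>\<^sub>E {0..<int q}) (colourings q A)"
  proof (rule bij_betwI[where g = "\<lambda>\<sigma>. \<lambda>X\<in>V // ?R. \<sigma> (SOME v. v \<in> X)"])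
    show "(\<lambda>g. \<lambda>v\<in>V. g (?R `` {v})) \<in> ((V // ?R) \<rightarrow>\<^sub>E {0..<int q}) \<rightarrow> colourings q A"
    proof
      fix g assume g: "g \<in> (V // ?R) \<rightarrow>\<^sub>E {0..<int q}"
      have "(u, v) \<in> ?R \<Longrightarrow> ?R `` {u} = ?R `` {v} \<and> u \<in> V \<and> v \<in> V" for u v
        using equiv_class_eq_iff[OF eq] by simp
      moreover have "v \<in> V \<Longrightarrow> g (?R `` {v}) \<in> {0..<int q}" for v
        using g by (auto intro!: PiE_mem[OF g] quotientI)
      ultimately show "(\<lambda>v\<in>V. g (?R `` {v})) \<in> colourings q A"
        by (auto simp: colourings_def)
    qed
  next
    have some: "(SOME v. v \<in> X) \<in> X" if "X \<in> V // ?R" for X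
      using in_quotient_imp_non_empty[OF eq that] by (simp add: some_in_eq)
    show "(\<lambda>\<sigma>. \<lambda>X\<in>V // ?R. \<sigma> (SOME v. v \<in> X)) \<in> colourings q A \<rightarrow> ((V // ?R) \<rightarrow>\<^sub>E {0..<int q})"
    proof
      fix \<sigma> assume \<sigma>: "\<sigma> \<in> colourings q A"
      then have "\<sigma> (SOME v. v \<in> X) \<in> {0..<int q}" if "X \<in> V // ?R" for X
        using in_quotient_imp_subset[OF eq that] some[OF that]
        by (auto simp: colourings_def PiE_iff subset_iff)
      then show "(\<lambda>X\<in>V // ?R. \<sigma> (SOME v. v \<in> X)) \<in> (V // ?R) \<rightarrow>\<^sub>E {0..<int q}"
        by auto
    qed
    show "(\<lambda>X\<in>V // ?R. (\<lambda>v\<in>V. g (?R `` {v})) (SOME v. v \<in> X)) = g"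
      if g: "g \<in> (V // ?R) \<rightarrow>\<^sub>E {0..<int q}" for g
    proof
      fix X
      show "(\<lambda>X\<in>V // ?R. (\<lambda>v\<in>V. g (?R `` {v})) (SOME v. v \<in> X)) X = g X"
      proof (cases "X \<in> V // ?R")
        case True
        have "(SOME v. v \<in> X) \<in> V"
          using in_quotient_imp_subset[OF eq True] some[OF True] by blast
        moreover have "?R `` {SOME v. v \<in> X} = X"
          using True
        proof (rule quotientE)
          fix x assume x: "X = ?R `` {x}"
          then have "(x, SOME v. v \<in> X) \<in> ?R" using some[OF True] by blast
          then show ?thesis using equiv_class_eq[OF eq, of x "SOME v. v \<in> X"] x by argo
        qed
        ultimately show ?thesis using True by simp
      qed (use g in \<open>auto simp: PiE_iff extensional_def\<close>)
    qed
    show "(\<lambda>v\<in>V. (\<lambda>X\<in>V // ?R. \<sigma> (SOME v. v \<in> X)) (?R `` {v})) = \<sigma>"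
      if \<sigma>: "\<sigma> \<in> colourings q A" for \<sigma>
    proof
      fix v
      show "(\<lambda>v\<in>V. (\<lambda>X\<in>V // ?R. \<sigma> (SOME v. v \<in> X)) (?R `` {v})) v = \<sigma> v"
      proof (cases "v \<in> V")
        case True
        then have X: "?R `` {v} \<in> V // ?R" by (rule quotientI)
        from some[OF X] have "(v, SOME w. w \<in> ?R `` {v}) \<in> ?R" by simp
        then have "\<sigma> (SOME w. w \<in> ?R `` {v}) = \<sigma> v"
          using \<sigma> by (fastforce simp: colourings_def)
        then show ?thesis using True X by simp
      qed (use \<sigma> in \<open>auto simp: colourings_def PiE_iff extensional_def\<close>)
    qed
  qed
  then have "card (colourings q A) = card ((V // ?R) \<rightarrow>\<^sub>E {0..<int q})"
    by (simp add: bij_betw_same_card)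
  then show ?thesis
    by (simp add: card_PiE finite_components num_components_def)
qed


text \<open>
  Exchanging the configurations \<open>A\<close> and \<open>B\<close> on the edges in \<open>F\<close>: the first component of the
  exchanged pair is \<open>exchange F A B\<close>, the second one is \<open>exchange F B A\<close>.
\<close>

definition exchange :: "'v set set \<Rightarrow> 'v set set \<Rightarrow> 'v set set \<Rightarrow> 'v set set" where
  "exchange F A B = (B \<inter> F) \<union> (A - F)"

text \<open>
  Two colourings that agree on the vertices separating \<open>F\<close> from the other edges can be exchanged
  along with the configurations. Here \<open>\<sigma>\<close> is replaced by \<open>\<tau>\<close> on the vertices of \<open>F\<close>.
\<close>

lemma exchange_colourings:
  assumes "A \<subseteq> E" "B \<subseteq> E"
    and cut: "\<And>v f e. \<lbrakk>v \<in> f; f \<in> F; f \<in> E; v \<in> e; e \<in> E - F\<rbrakk> \<Longrightarrow> v \<in> T"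
    and \<sigma>: "\<sigma> \<in> colourings q A" and \<tau>: "\<tau> \<in> colourings q B"
    and agree: "\<And>v. v \<in> T \<Longrightarrow> \<sigma> v = \<tau> v"
  shows "(\<lambda>v. if v \<in> \<Union>(E \<inter> F) then \<tau> v else \<sigma> v) \<in> colourings q (exchange F A B)"
proof -
  have sub: "exchange F A B \<subseteq> E" using assms(1,2) by (auto simp: exchange_def)
  have \<sigma>': "\<sigma> \<in> V \<rightarrow>\<^sub>E {0..<int q}" "\<And>u v. {u, v} \<in> A \<Longrightarrow> \<sigma> u = \<sigma> v"
    using \<sigma> by (simp_all add: colourings_iff[OF assms(1)])
  have \<tau>': "\<tau> \<in> V \<rightarrow>\<^sub>E {0..<int q}" "\<And>u v. {u, v} \<in> B \<Longrightarrow> \<tau> u = \<tau> v"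
    using \<tau> by (simp_all add: colourings_iff[OF assms(2)])
  let ?\<rho> = "\<lambda>v. if v \<in> \<Union>(E \<inter> F) then \<tau> v else \<sigma> v"
  have "?\<rho> u = ?\<rho> v" if uv: "{u, v} \<in> exchange F A B" for u v
  proof (cases "{u, v} \<in> F")
    case True
    then have "{u, v} \<in> B" using uv by (auto simp: exchange_def)
    moreover have "u \<in> \<Union>(E \<inter> F)" "v \<in> \<Union>(E \<inter> F)" using True uv sub by blast+
    ultimately show ?thesis using \<tau>'(2)[of u v] by simp
  next
    case False
    then have A: "{u, v} \<in> A" using uv by (auto simp: exchange_def)
    have "?\<rho> w = \<sigma> w" if "w \<in> {u, v}" for w
      using cut[of w _ "{u, v}"] that A False assms(1) agree[of w] by auto
    then show ?thesis using \<sigma>'(2)[OF A] by simp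
  qed
  moreover have "?\<rho> \<in> V \<rightarrow>\<^sub>E {0..<int q}"
    using \<sigma>'(1) \<tau>'(1) by (auto simp: PiE_iff extensional_def)
  ultimately show ?thesis by (simp add: colourings_iff[OF sub])
qed

lemma colourings_shift:
  assumes "A \<subseteq> E" "\<sigma> \<in> colourings q A" "\<tau> \<in> colourings q A" "0 < q"
  shows "(\<lambda>v\<in>V. (\<sigma> v - \<tau> v) mod int q) \<in> colourings q A"
    and "(\<lambda>v\<in>V. (\<sigma> v + k) mod int q) \<in> colourings q A"
  using assms edge_subset by (auto simp: colourings_iff[OF assms(1)] PiE_iff)

text \<open>
  The crucial estimate on the number of components. Mapping a pair of colourings of \<open>A\<close> and \<open>B\<close>
  to its difference on the separating set \<open>T\<close> has fibres no larger than the set of pairs that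
  agree on \<open>T\<close>. Such pairs are exchanged to colourings of the exchanged configurations that
  still agree on \<open>T\<close>, and adding constants to the second colouring shows that at most a
  \<open>q\<close>-th of all pairs of colourings of the exchanged configurations arises in this way.
\<close>

lemma card_colourings_exchange:
  assumes AB: "A \<subseteq> E" "B \<subseteq> E" and q: "0 < q"
    and cut: "\<And>v f e. \<lbrakk>v \<in> f; f \<in> F; f \<in> E; v \<in> e; e \<in> E - F\<rbrakk> \<Longrightarrow> v \<in> T"
    and T: "T \<subseteq> V" "T \<noteq> {}"
  shows "card (colourings q A) * card (colourings q B) * q
    \<le> q ^ card T * (card (colourings q (exchange F A B)) * card (colourings q (exchange F B A)))"
proof -
  let ?X = "exchange F A B" and ?Y = "exchange F B A"
  define K where "K = {(\<sigma>, \<tau>) \<in> colourings q A \<times> colourings q B. \<forall>v\<in>T. \<sigma> v = \<tau> v}"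
  define fibre where "fibre \<delta> =
    {(\<sigma>, \<tau>) \<in> colourings q A \<times> colourings q B. \<forall>v\<in>T. (\<sigma> v - \<tau> v) mod int q = \<delta> v}" for \<delta>
  have finite_K: "finite K"
    by (rule finite_subset[of _ "colourings q A \<times> colourings q B"])
       (auto simp: K_def finite_colourings)
  have finite_T: "finite T" using T finite_V finite_subset by blast
  have range: "\<sigma> v \<in> {0..<int q}" if "\<sigma> \<in> colourings q C" "v \<in> V" for \<sigma> C v
    using that by (auto simp: colourings_def)
  have ext: "\<sigma> = \<sigma>'" if "\<sigma> \<in> colourings q C" "\<sigma>' \<in> colourings q C'" "\<And>v. v \<in> V \<Longrightarrow> \<sigma> v = \<sigma>' v" for \<sigma> \<sigma>' C C'
    using that by (intro PiE_ext[of \<sigma> V "\<lambda>_. {0..<int q}"]) (auto simp: colourings_def)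
  have cancel: "a = b" if "(a - c) mod int q = (b - c) mod int q" "a \<in> {0..<int q}" "b \<in> {0..<int q}"
    for a b c :: int
  proof -
    have "a mod int q = b mod int q"
      using mod_add_cong[OF that(1) refl[of "c mod int q"]] by simp
    then show ?thesis using that by simp
  qed
  \<comment> \<open>Subtracting a fixed element of the fibre embeds it into \<open>K\<close>.\<close>
  have card_fibre: "card (fibre \<delta>) \<le> card K" for \<delta>
  proof (cases "fibre \<delta> = {}")
    case False
    then obtain \<sigma>0 \<tau>0 where base: "\<sigma>0 \<in> colourings q A" "\<tau>0 \<in> colourings q B"
      and base_diff: "\<And>v. v \<in> T \<Longrightarrow> (\<sigma>0 v - \<tau>0 v) mod int q = \<delta> v"
      by (auto simp: fibre_def)
    let ?h = "\<lambda>(\<sigma>, \<tau>). (\<lambda>v\<in>V. (\<sigma> v - \<sigma>0 v) mod int q, \<lambda>v\<in>V. (\<tau> v - \<tau>0 v) mod int q)"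
    show ?thesis
    proof (rule card_inj_on_le[of ?h])
      show "inj_on ?h (fibre \<delta>)"
      proof (rule inj_onI, clarify)
        fix \<sigma> \<tau> \<sigma>' \<tau>'
        assume mem: "(\<sigma>, \<tau>) \<in> fibre \<delta>" "(\<sigma>', \<tau>') \<in> fibre \<delta>"
          and eq1: "(\<lambda>v\<in>V. (\<sigma> v - \<sigma>0 v) mod int q) = (\<lambda>v\<in>V. (\<sigma>' v - \<sigma>0 v) mod int q)"
          and eq2: "(\<lambda>v\<in>V. (\<tau> v - \<tau>0 v) mod int q) = (\<lambda>v\<in>V. (\<tau>' v - \<tau>0 v) mod int q)"
        have cols: "\<sigma> \<in> colourings q A" "\<sigma>' \<in> colourings q A" "\<tau> \<in> colourings q B" "\<tau>' \<in> colourings q B"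
          using mem by (auto simp: fibre_def)
        show "\<sigma> = \<sigma>' \<and> \<tau> = \<tau>'"
        proof
          show "\<sigma> = \<sigma>'"
          proof (rule ext[OF cols(1,2)])
            fix v assume v: "v \<in> V"
            show "\<sigma> v = \<sigma>' v"
              using cancel[OF _ range[OF cols(1) v] range[OF cols(2) v]] fun_cong[OF eq1, of v] v by simp
          qed
          show "\<tau> = \<tau>'"
          proof (rule ext[OF cols(3,4)])
            fix v assume v: "v \<in> V"
            show "\<tau> v = \<tau>' v"
              using cancel[OF _ range[OF cols(3) v] range[OF cols(4) v]] fun_cong[OF eq2, of v] v by simp
          qed
        qed
      qed
      show "?h ` fibre \<delta> \<subseteq> K"
      proof clarify
        fix \<sigma> \<tau> assume mem: "(\<sigma>, \<tau>) \<in> fibre \<delta>"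
        have "(\<sigma> v - \<sigma>0 v) mod int q = (\<tau> v - \<tau>0 v) mod int q" if "v \<in> T" for v
        proof -
          have "(\<sigma> v - \<tau> v) mod int q = (\<sigma>0 v - \<tau>0 v) mod int q"
            using mem base_diff[OF that] that by (auto simp: fibre_def)
          from mod_add_cong[OF this refl[of "(\<tau> v - \<sigma>0 v) mod int q"]]
          show ?thesis by (simp add: algebra_simps)
        qed
        then show "(\<lambda>v\<in>V. (\<sigma> v - \<sigma>0 v) mod int q, \<lambda>v\<in>V. (\<tau> v - \<tau>0 v) mod int q) \<in> K"
          using colourings_shift(1)[OF AB(1) _ base(1) q] colourings_shift(1)[OF AB(2) _ base(2) q] mem T(1)
          by (auto simp: K_def fibre_def subset_iff)
      qed
    qed (rule finite_K)
  qed simp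
  have "card (colourings q A) * card (colourings q B) = card (colourings q A \<times> colourings q B)"
    by (simp add: card_cartesian_product)
  also have "\<dots> \<le> card (\<Union>\<delta>\<in>T \<rightarrow>\<^sub>E {0..<int q}. fibre \<delta>)"
  proof (rule card_mono)
    show "finite (\<Union>\<delta>\<in>T \<rightarrow>\<^sub>E {0..<int q}. fibre \<delta>)"
      by (rule finite_subset[of _ "colourings q A \<times> colourings q B"])
         (auto simp: fibre_def finite_colourings)
    show "colourings q A \<times> colourings q B \<subseteq> (\<Union>\<delta>\<in>T \<rightarrow>\<^sub>E {0..<int q}. fibre \<delta>)"
    proof clarify
      fix \<sigma> \<tau> assume "\<sigma> \<in> colourings q A" "\<tau> \<in> colourings q B"
      then show "(\<sigma>, \<tau>) \<in> (\<Union>\<delta>\<in>T \<rightarrow>\<^sub>E {0..<int q}. fibre \<delta>)"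
        using q by (intro UN_I[of "\<lambda>v\<in>T. (\<sigma> v - \<tau> v) mod int q"]) (auto simp: fibre_def)
    qed
  qed
  also have "\<dots> \<le> (\<Sum>\<delta>\<in>T \<rightarrow>\<^sub>E {0..<int q}. card (fibre \<delta>))"
    by (rule card_UN_le) (simp add: finite_T finite_PiE)
  also have "\<dots> \<le> of_nat (card (T \<rightarrow>\<^sub>E {0..<int q})) * card K"
    by (rule sum_bounded_above) (rule card_fibre)
  also have "\<dots> = q ^ card T * card K"
    by (simp add: card_PiE finite_T)
  finally have "card (colourings q A) * card (colourings q B) * q \<le> q ^ card T * (card K * card {0..<int q})"
    by (simp add: mult.assoc)
  also have "card K * card {0..<int q} \<le> card (colourings q ?X) * card (colourings q ?Y)"
  proof -
    let ?\<rho> = "\<lambda>\<sigma> \<tau> v. if v \<in> \<Union>(E \<inter> F) then \<tau> v else \<sigma> v"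
    let ?h = "\<lambda>((\<sigma>, \<tau>), k). (?\<rho> \<sigma> \<tau>, \<lambda>v\<in>V. (?\<rho> \<tau> \<sigma> v + k) mod int q)"
    have XY: "?X \<subseteq> E" "?Y \<subseteq> E" using AB by (auto simp: exchange_def)
    have "card (K \<times> {0..<int q}) \<le> card (colourings q ?X \<times> colourings q ?Y)"
    proof (rule card_inj_on_le[of ?h])
      show "?h ` (K \<times> {0..<int q}) \<subseteq> colourings q ?X \<times> colourings q ?Y"
      proof (rule image_subsetI)
        fix a assume "a \<in> K \<times> {0..<int q}"
        then obtain \<sigma> \<tau> k where a: "a = ((\<sigma>, \<tau>), k)" and "(\<sigma>, \<tau>) \<in> K" by auto
        then have *: "\<sigma> \<in> colourings q A" "\<tau> \<in> colourings q B" "\<And>v. v \<in> T \<Longrightarrow> \<sigma> v = \<tau> v"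
          by (auto simp: K_def)
        have "?\<rho> \<sigma> \<tau> \<in> colourings q ?X"
          by (rule exchange_colourings[OF AB cut *(1,2)]) (use *(3) in auto)
        moreover have \<rho>: "?\<rho> \<tau> \<sigma> \<in> colourings q ?Y"
          by (rule exchange_colourings[OF AB(2,1) cut *(2,1)]) (use *(3) in auto)
        ultimately show "?h a \<in> colourings q ?X \<times> colourings q ?Y"
          using colourings_shift(2)[OF XY(2) \<rho> \<rho> q] by (simp only: a prod.case mem_Sigma_iff)
      qed
      show "inj_on ?h (K \<times> {0..<int q})"
      proof (rule inj_onI)
        fix a b assume a: "a \<in> K \<times> {0..<int q}" and b: "b \<in> K \<times> {0..<int q}" and "?h a = ?h b"
        obtain \<sigma> \<tau> k \<sigma>' \<tau>' k' where ab: "a = ((\<sigma>, \<tau>), k)" "b = ((\<sigma>', \<tau>'), k')"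
          by (metis prod.exhaust)
        have mem: "(\<sigma>, \<tau>) \<in> K" "(\<sigma>', \<tau>') \<in> K" and k: "k \<in> {0..<int q}" "k' \<in> {0..<int q}"
          using a b ab by auto
        have eq1: "?\<rho> \<sigma> \<tau> = ?\<rho> \<sigma>' \<tau>'"
          and eq2: "(\<lambda>v\<in>V. (?\<rho> \<tau> \<sigma> v + k) mod int q) = (\<lambda>v\<in>V. (?\<rho> \<tau>' \<sigma>' v + k') mod int q)"
          using \<open>?h a = ?h b\<close> by (simp_all only: ab prod.case prod.inject)
        have cols: "\<sigma> \<in> colourings q A" "\<sigma>' \<in> colourings q A" "\<tau> \<in> colourings q B" "\<tau>' \<in> colourings q B"
          using mem by (auto simp: K_def)
        \<comment> \<open>The colours at a single vertex of \<open>T\<close> recover the added constant.\<close>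
        obtain w where w: "w \<in> T" using T(2) by blast
        have "(?\<rho> \<sigma> \<tau> w + k) mod int q = (?\<rho> \<sigma> \<tau> w + k') mod int q"
          using fun_cong[OF eq2, of w] fun_cong[OF eq1, of w] mem w T(1)
          by (auto simp: K_def split: if_splits)
        from mod_add_cong[OF this refl[of "(- ?\<rho> \<sigma> \<tau> w) mod int q"]] have "k mod int q = k' mod int q"
          by (simp add: algebra_simps)
        then have kk: "k = k'" using k by simp
        have "?\<rho> \<tau> \<sigma> v = ?\<rho> \<tau>' \<sigma>' v" if v: "v \<in> V" for v
        proof (rule cancel[of _ "- k"])
          show "(?\<rho> \<tau> \<sigma> v - (- k)) mod int q = (?\<rho> \<tau>' \<sigma>' v - (- k)) mod int q"
            using fun_cong[OF eq2, of v] v kk by simp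
          show "?\<rho> \<tau> \<sigma> v \<in> {0..<int q}" "?\<rho> \<tau>' \<sigma>' v \<in> {0..<int q}"
            using range[OF cols(1) v] range[OF cols(2) v] range[OF cols(3) v] range[OF cols(4) v] by auto
        qed
        then have "\<sigma> v = \<sigma>' v \<and> \<tau> v = \<tau>' v" if v: "v \<in> V" for v
          using fun_cong[OF eq1, of v] v by (meson)
        then show "a = b"
          using ext[OF cols(1,2)] ext[OF cols(3,4)] kk ab by blast
      qed
    qed (simp add: finite_colourings)
    then show ?thesis by (simp add: card_cartesian_product)
  qed
  finally show ?thesis by simp
qed

end


section \<open>A Poincare inequality for the single-bond dynamics\<close>

lemma sum_Pow_bernoulli:
  fixes p :: real
  assumes "finite E"
  shows "(\<Sum>A\<in>Pow E. p ^ card A * (1 - p) ^ (card E - card A)) = 1"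
proof -
  have "(\<Prod>e\<in>E. p + (1 - p)) = (\<Sum>A\<in>Pow E. (\<Prod>e\<in>A. p) * (\<Prod>e\<in>E - A. 1 - p))"
    by (rule prod_add[OF assms])
  also have "\<dots> = (\<Sum>A\<in>Pow E. p ^ card A * (1 - p) ^ (card E - card A))"
    using assms by (intro sum.cong refl) (auto simp: card_Diff_subset finite_subset)
  finally show ?thesis by simp
qed

lemma sum_square_le:
  fixes f :: "nat \<Rightarrow> real"
  shows "(\<Sum>i<m. f i)\<^sup>2 \<le> real m * (\<Sum>i<m. (f i)\<^sup>2)"
proof (cases "m = 0")
  case False
  have "(\<Sum>i<m. 1 / real m * f i)\<^sup>2 \<le> (\<Sum>i<m. 1 / real m * (f i)\<^sup>2)"
    using False by (intro weighted_jensen_square) auto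
  then show ?thesis
    using False by (simp add: power_divide power2_eq_square field_simps flip: sum_divide_distrib)
qed simp

text \<open>The random-cluster model with parameters \<open>p\<close> and \<open>q\<close> on a finite graph with at least one edge.\<close>

locale random_cluster = finite_graph V E for V :: "'v set" and E +
  fixes p :: real and q :: nat
  assumes p: "0 < p" "p < 1" and q: "1 \<le> q" and E_nonempty: "E \<noteq> {}"
begin

abbreviation weight :: "'v set set \<Rightarrow> real" where "weight \<equiv> rc_weight V p q"
abbreviation \<mu> :: "'v set set \<Rightarrow> real" where "\<mu> \<equiv> rc_measure V E p q"
abbreviation update :: "'v set \<Rightarrow> 'v set set \<Rightarrow> 'v set set \<Rightarrow> real" where
  "update \<equiv> bond_update V p q"

text \<open>The probability with which the update of the edge \<open>e\<close> in the configuration \<open>A\<close> opens \<open>e\<close>.\<close>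

definition open_rate :: "'v set \<Rightarrow> 'v set set \<Rightarrow> real" where
  "open_rate e A = (if ends_connected V A e then p else p / real q)"

lemma open_rate_bounds: "0 < open_rate e A" "open_rate e A < 1"
proof -
  have "p / real q \<le> p / 1" using p q by (intro divide_left_mono) auto
  then show "0 < open_rate e A" "open_rate e A < 1" using p q by (auto simp: open_rate_def)
qed

lemma weight_pos: "0 < weight A"
  using p q by (auto simp: rc_weight_def)

lemma partition_pos: "0 < rc_partition V E p q"
  unfolding rc_partition_def using finite_E by (intro sum_pos weight_pos) auto

lemma measure_pos: "0 < \<mu> A"
  unfolding rc_measure_def by (intro divide_pos_pos weight_pos partition_pos)

lemma measure_sum: "(\<Sum>A\<in>Pow E. \<mu> A) = 1"
  using partition_pos by (simp add: rc_measure_def rc_partition_def flip: sum_divide_distrib)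

lemma card_E_pos: "0 < card E"
  using finite_E E_nonempty by (simp add: card_gt_0_iff)

lemma ends_connected_self:
  assumes "e \<in> A" "e \<in> E"
  shows "ends_connected V A e"
proof -
  obtain u v where "u \<in> V" "v \<in> V" "e = {u, v}" using edgeE[OF assms(2)] by blast
  then show ?thesis using assms(1) by (auto simp: ends_connected_def conn_rel_def adj_rel_def)
qed

text \<open>
  Opening \<open>e\<close> multiplies the weight by \<open>p / (1 - p)\<close>, and by \<open>1 / q\<close> if it joins two components.
  This is detailed balance for the update of \<open>e\<close>, because an open edge is closed at the rate
  \<open>1 - p\<close> in either case.
\<close>

lemma weight_insert:
  assumes "A \<subseteq> E" "e \<in> E" "e \<notin> A"
  shows "weight A * open_rate e A = (1 - p) * weight (insert e A)"
proof -
  obtain u v where e: "u \<in> V" "v \<in> V" "e = {u, v}" using edgeE[OF assms(2)] by blast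
  have card: "card (insert e A) = Suc (card A)"
    using assms finite_E by (simp add: finite_subset)
  have conn_iff: "ends_connected V A e \<longleftrightarrow> (u, v) \<in> conn_rel V A"
    using conn_sym[of _ _ A] by (auto simp: ends_connected_def e doubleton_eq_iff)
  show ?thesis
  proof (cases "ends_connected V A e")
    case True
    then have "num_components V (insert e A) = num_components V A"
      using num_components_insert_connected conn_iff e by simp
    then show ?thesis using True p card by (simp add: rc_weight_def open_rate_def)
  next
    case False
    then have "num_components V A = Suc (num_components V (insert e A))"
      using num_components_insert_disconnected[of u v A] conn_iff e by simp
    then show ?thesis using False p q card by (simp add: rc_weight_def open_rate_def)
  qed
qed

lemma measure_insert:
  assumes "A \<subseteq> E" "e \<in> E" "e \<notin> A"
  shows "\<mu> A * open_rate e A = (1 - p) * \<mu> (insert e A)"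
  using weight_insert[OF assms] by (simp add: rc_measure_def field_simps)

lemma bond_update_eq:
  "update e A B = (if B = insert e A then open_rate e A
     else if B = A - {e} then 1 - open_rate e A else 0)"
proof -
  have sub: "(A - B) \<union> (B - A) \<subseteq> {e} \<longleftrightarrow> B = insert e A \<or> B = A - {e}" by auto
  have card: "card (B \<inter> {e}) = (if e \<in> B then 1 else 0)" by auto
  show ?thesis unfolding bond_update_def sub card open_rate_def by auto
qed

lemma sum_bond_update:
  assumes "A \<subseteq> E" "e \<in> E"
  shows "(\<Sum>B\<in>Pow E. update e A B * g B)
    = open_rate e A * g (insert e A) + (1 - open_rate e A) * g (A - {e})"
proof -
  have ne: "insert e A \<noteq> A - {e}" by auto
  have "(\<Sum>B\<in>Pow E. update e A B * g B) = (\<Sum>B\<in>{insert e A, A - {e}}. update e A B * g B)"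
    using assms finite_E by (intro sum.mono_neutral_right) (auto simp: bond_update_eq)
  also have "\<dots> = open_rate e A * g (insert e A) + (1 - open_rate e A) * g (A - {e})"
    using ne by (simp add: bond_update_eq)
  finally show ?thesis .
qed

lemma bond_update_nonneg: "0 \<le> update e A B"
  using open_rate_bounds[of e A] by (simp add: bond_update_eq)

lemma bond_update_reversible:
  assumes "A \<subseteq> E" "B \<subseteq> E" "e \<in> E"
  shows "\<mu> A * update e A B = \<mu> B * update e B A"
proof -
  have flip: "\<mu> C * update e C (insert e C) = \<mu> (insert e C) * update e (insert e C) C"
    if "C \<subseteq> E" "e \<notin> C" for C
  proof -
    have "open_rate e (insert e C) = p"
      using ends_connected_self[of e "insert e C"] assms by (simp add: open_rate_def)
    moreover have "C \<noteq> insert e C" "insert e C - {e} = C" using that by auto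
    ultimately have "update e (insert e C) C = 1 - p"
      by (simp add: bond_update_eq)
    then show ?thesis using measure_insert[OF that(1) assms(3) that(2)] by (simp add: bond_update_eq)
  qed
  consider "A = B" | "B = insert e A" "e \<notin> A" | "A = insert e B" "e \<notin> B"
    | "B \<noteq> insert e A" "B \<noteq> A - {e}" "A \<noteq> insert e B" "A \<noteq> B - {e}"
    by blast
  then show ?thesis
  proof cases
    case 2
    then show ?thesis using flip[of A] assms by simp
  next
    case 3
    then show ?thesis using flip[of B] assms by simp
  qed (simp_all add: bond_update_eq)
qed

sublocale lazy_reversible_chain "Pow E" "single_bond V E p q" \<mu>
proof
  show "finite (Pow E)" using finite_E by simp
  show "0 \<le> single_bond V E p q A B" for A B
    by (auto simp: single_bond_def intro!: add_nonneg_nonneg divide_nonneg_nonneg sum_nonneg bond_update_nonneg)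
  show "(\<Sum>B\<in>Pow E. single_bond V E p q A B) = 1" if "A \<in> Pow E" for A
  proof -
    have "(\<Sum>B\<in>Pow E. \<Sum>e\<in>E. update e A B) = (\<Sum>e\<in>E. \<Sum>B\<in>Pow E. update e A B)"
      by (rule sum.swap)
    also have "\<dots> = real (card E)"
      using sum_bond_update[of A _ "\<lambda>_. 1"] that by simp
    finally show ?thesis
      using that finite_E E_nonempty
      by (simp add: single_bond_def sum.distrib flip: sum_divide_distrib)
  qed
  show "1 / 2 \<le> single_bond V E p q A A" for A
    by (simp add: single_bond_def sum_nonneg bond_update_nonneg)
  show "\<mu> A * single_bond V E p q A B = \<mu> B * single_bond V E p q B A"
    if "A \<in> Pow E" "B \<in> Pow E" for A B
  proof -
    have "\<mu> A * (\<Sum>e\<in>E. update e A B) = \<mu> B * (\<Sum>e\<in>E. update e B A)"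
      unfolding sum_distrib_left using that by (intro sum.cong refl bond_update_reversible) auto
    then show ?thesis by (auto simp: single_bond_def field_simps)
  qed
qed (simp_all add: measure_pos measure_sum)

text \<open>
  The energy of \<open>f\<close> across the edge \<open>e\<close>. Each unordered pair \<open>{X - {e}, X}\<close> is represented by
  its larger element.
\<close>

definition edge_energy :: "('v set set \<Rightarrow> real) \<Rightarrow> 'v set \<Rightarrow> real" where
  "edge_energy f e = (\<Sum>X | X \<subseteq> E \<and> e \<in> X. \<mu> X * (f X - f (X - {e}))\<^sup>2)"

lemma dirichlet_single_bond:
  "dirichlet f = (1 - p) / (2 * real (card E)) * (\<Sum>e\<in>E. edge_energy f e)"
proof -
  have edge: "(\<Sum>A\<in>Pow E. \<Sum>B\<in>Pow E. \<mu> A * (update e A B * (f A - f B)\<^sup>2))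
      = 2 * (1 - p) * edge_energy f e" if e: "e \<in> E" for e
  proof -
    let ?D = "\<lambda>A. \<mu> A * (open_rate e A * (f A - f (insert e A))\<^sup>2 + (1 - open_rate e A) * (f A - f (A - {e}))\<^sup>2)"
    have "(\<Sum>A\<in>Pow E. \<Sum>B\<in>Pow E. \<mu> A * (update e A B * (f A - f B)\<^sup>2)) = (\<Sum>A\<in>Pow E. ?D A)"
      using e by (intro sum.cong refl) (simp add: sum_bond_update flip: sum_distrib_left)
    also have "\<dots> = (\<Sum>A\<in>{A. A \<subseteq> E \<and> e \<in> A} \<union> {A. A \<subseteq> E \<and> e \<notin> A}. ?D A)"
      by (intro sum.cong refl) auto
    also have "\<dots> = (\<Sum>A | A \<subseteq> E \<and> e \<in> A. ?D A) + (\<Sum>A | A \<subseteq> E \<and> e \<notin> A. ?D A)"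
      using finite_E by (intro sum.union_disjoint) auto
    also have "(\<Sum>A | A \<subseteq> E \<and> e \<in> A. ?D A) = (1 - p) * edge_energy f e"
      unfolding edge_energy_def sum_distrib_left
    proof (intro sum.cong refl)
      fix A assume "A \<in> {A. A \<subseteq> E \<and> e \<in> A}"
      moreover from this have "open_rate e A = p"
        using ends_connected_self[OF _ e] by (simp add: open_rate_def)
      ultimately show "?D A = (1 - p) * (\<mu> A * (f A - f (A - {e}))\<^sup>2)"
        by (simp add: insert_absorb)
    qed
    also have "(\<Sum>A | A \<subseteq> E \<and> e \<notin> A. ?D A) = (\<Sum>X | X \<subseteq> E \<and> e \<in> X. (1 - p) * (\<mu> X * (f X - f (X - {e}))\<^sup>2))"
    proof (rule sum.reindex_bij_witness[of _ "\<lambda>X. X - {e}" "insert e"])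
      fix A assume A: "A \<in> {A. A \<subseteq> E \<and> e \<notin> A}"
      then have "A - {e} = A" "insert e A - {e} = A" by auto
      moreover have "\<mu> A * open_rate e A = (1 - p) * \<mu> (insert e A)"
        using measure_insert[of A e] A e by simp
      ultimately show "(1 - p) * (\<mu> (insert e A) * (f (insert e A) - f (insert e A - {e}))\<^sup>2) = ?D A"
        by (simp add: power2_commute flip: mult.assoc)
    qed (use e in auto)
    also have "\<dots> = (1 - p) * edge_energy f e"
      by (simp add: edge_energy_def sum_distrib_left)
    finally show ?thesis by simp
  qed
  let ?t = "\<lambda>A B e. 1 / (2 * real (card E)) * (\<mu> A * (update e A B * (f A - f B)\<^sup>2))"
  have "dirichlet f = 1 / 2 * (\<Sum>A\<in>Pow E. \<Sum>B\<in>Pow E. \<Sum>e\<in>E. ?t A B e)"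
    unfolding dirichlet_def
    by (intro arg_cong2[where f = "(*)"] sum.cong refl)
       (auto simp: single_bond_def sum_distrib_left sum_distrib_right mult_ac)
  also have "(\<Sum>A\<in>Pow E. \<Sum>B\<in>Pow E. \<Sum>e\<in>E. ?t A B e) = (\<Sum>A\<in>Pow E. \<Sum>e\<in>E. \<Sum>B\<in>Pow E. ?t A B e)"
    by (intro sum.cong refl sum.swap)
  also have "\<dots> = (\<Sum>e\<in>E. \<Sum>A\<in>Pow E. \<Sum>B\<in>Pow E. ?t A B e)"
    by (rule sum.swap)
  also have "\<dots> = (\<Sum>e\<in>E. 1 / (2 * real (card E)) * (2 * (1 - p) * edge_energy f e))"
  proof (intro sum.cong refl)
    fix e assume "e \<in> E"
    then show "(\<Sum>A\<in>Pow E. \<Sum>B\<in>Pow E. ?t A B e) = 1 / (2 * real (card E)) * (2 * (1 - p) * edge_energy f e)"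
      by (simp only: edge[symmetric] sum_distrib_left)
  qed
  also have "1 / 2 * \<dots> = (1 - p) / (2 * real (card E)) * (\<Sum>e\<in>E. edge_energy f e)"
    using card_E_pos unfolding sum_distrib_left by (intro sum.cong refl) (simp add: field_simps)
  finally show ?thesis .
qed

text \<open>
  This bound compensates the factor \<open>1 - p\<close> in the Dirichlet form, so that the constant in the
  Poincare inequality below does not depend on \<open>p\<close>.
\<close>

lemma measure_edge_closed_le:
  assumes "e \<in> E"
  shows "(\<Sum>A | A \<subseteq> E \<and> e \<notin> A. \<mu> A) \<le> (1 - p) * real q"
proof -
  let ?N = "\<Sum>A | A \<subseteq> E \<and> e \<notin> A. \<mu> A"
  have N: "0 \<le> ?N" by (intro sum_nonneg) (simp add: measure_pos less_imp_le)
  have "p / real q * ?N \<le> (1 - p) * (\<Sum>X | X \<subseteq> E \<and> e \<in> X. \<mu> X)"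
  proof -
    have "p / real q * ?N \<le> (\<Sum>A | A \<subseteq> E \<and> e \<notin> A. \<mu> A * open_rate e A)"
      unfolding sum_distrib_left
    proof (rule sum_mono)
      fix A
      have "p / real q \<le> open_rate e A"
        using p q divide_left_mono[of 1 "real q" p] by (simp add: open_rate_def)
      then show "p / real q * \<mu> A \<le> \<mu> A * open_rate e A"
        using mult_left_mono[of "p / real q" "open_rate e A" "\<mu> A"] measure_pos[of A]
        by (simp add: mult.commute)
    qed
    also have "\<dots> = (\<Sum>X | X \<subseteq> E \<and> e \<in> X. (1 - p) * \<mu> X)"
      using assms
      by (intro sum.reindex_bij_witness[of _ "\<lambda>X. X - {e}" "insert e"]) (auto simp: measure_insert)
    finally show ?thesis by (simp add: sum_distrib_left)
  qed
  moreover have "(\<Sum>X | X \<subseteq> E \<and> e \<in> X. \<mu> X) = 1 - ?N"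
  proof -
    have "Pow E = {A. A \<subseteq> E \<and> e \<notin> A} \<union> {A. A \<subseteq> E \<and> e \<in> A}" by auto
    then have "(\<Sum>A\<in>{A. A \<subseteq> E \<and> e \<notin> A} \<union> {A. A \<subseteq> E \<and> e \<in> A}. \<mu> A) = 1"
      using measure_sum by simp
    then show ?thesis
      using finite_E by (subst (asm) sum.union_disjoint) auto
  qed
  ultimately have "p / real q * ?N \<le> (1 - p) * (1 - ?N)" by simp
  then have "(p / real q + (1 - p)) * ?N \<le> 1 - p" by (simp add: algebra_simps)
  then have "(p + (1 - p) * real q) * ?N \<le> (1 - p) * real q"
    using q by (simp add: field_simps)
  moreover have "1 \<le> p + (1 - p) * real q"
  proof -
    have "(1 - p) * 1 \<le> (1 - p) * real q" using p q by (intro mult_left_mono) auto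
    then show ?thesis by simp
  qed
  then have "1 * ?N \<le> (p + (1 - p) * real q) * ?N"
    using N by (rule mult_right_mono)
  ultimately show ?thesis by linarith
qed

lemma card_exchange:
  assumes "A \<subseteq> E" "B \<subseteq> E"
  shows "card (exchange F A B) + card (exchange F B A) = card A + card B"
proof -
  have split: "card C = card (C \<inter> F) + card (C - F)" if "C \<subseteq> E" for C
    using card_Int_Diff that finite_E finite_subset by blast
  have "card (exchange F C D) = card (D \<inter> F) + card (C - F)" if "C \<subseteq> E" "D \<subseteq> E" for C D
    unfolding exchange_def using that finite_E
    by (intro card_Un_disjoint) (auto intro: finite_subset)
  then show ?thesis using split[OF assms(1)] split[OF assms(2)] assms by simp
qed

lemma exchange_exchange: "exchange F (exchange F A B) (exchange F B A) = A"
  by (auto simp: exchange_def)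

lemma measure_exchange_le:
  assumes AB: "A \<subseteq> E" "B \<subseteq> E" and "cut_bound F s"
  shows "real q * (\<mu> A * \<mu> B) \<le> real q ^ s * (\<mu> (exchange F A B) * \<mu> (exchange F B A))"
proof -
  let ?X = "exchange F A B" and ?Y = "exchange F B A"
  obtain T where T: "T \<subseteq> V" "T \<noteq> {}" "card T \<le> s"
      "\<And>v f e. \<lbrakk>v \<in> f; f \<in> F; f \<in> E; v \<in> e; e \<in> E - F\<rbrakk> \<Longrightarrow> v \<in> T"
    using assms(3) by (auto simp: cut_bound_def) blast
  have "q ^ num_components V A * q ^ num_components V B * q
      \<le> q ^ card T * (q ^ num_components V ?X * q ^ num_components V ?Y)"
    using card_colourings_exchange[OF AB _ T(4,1,2)] q by (simp add: card_colourings)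
  also have "\<dots> \<le> q ^ s * (q ^ num_components V ?X * q ^ num_components V ?Y)"
    using q T(3) by (intro mult_right_mono power_increasing) auto
  finally have "real (q ^ num_components V A * q ^ num_components V B * q)
      \<le> real (q ^ s * (q ^ num_components V ?X * q ^ num_components V ?Y))"
    by (simp only: of_nat_le_iff)
  then have comps: "real q * (real q ^ num_components V A * real q ^ num_components V B)
      \<le> real q ^ s * (real q ^ num_components V ?X * real q ^ num_components V ?Y)"
    by (simp add: mult_ac)
  have weights: "weight C * weight D = (p / (1 - p)) ^ (card C + card D)
      * (real q ^ num_components V C * real q ^ num_components V D)" for C D
    by (simp add: rc_weight_def power_add)
  have "real q * (weight A * weight B) \<le> real q ^ s * (weight ?X * weight ?Y)"
    using mult_left_mono[OF comps, of "(p / (1 - p)) ^ (card A + card B)"] p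
    unfolding weights card_exchange[OF AB] by (simp add: mult_ac)
  then show ?thesis
    using partition_pos by (simp add: rc_measure_def divide_right_mono)
qed

text \<open>
  The congestion estimate for one step of the canonical paths. On the left are the pairs \<open>(A, B)\<close>
  for which \<open>e\<close> is open in \<open>X = exchange F A B\<close> and closed in the complementary configuration
  \<open>Y = exchange F B A\<close>. The exchange is an involution, so that \<open>(A, B)\<close> may be replaced by \<open>(X, Y)\<close>
  as the summation variable, and the sum over \<open>Y\<close> is the probability that \<open>e\<close> is closed.
\<close>

lemma exchange_congestion:
  assumes e: "e \<in> E" and cut: "cut_bound F s" and g: "\<And>X. 0 \<le> g X"
  shows "(\<Sum>(A, B)\<in>Pow E \<times> Pow E. if e \<in> exchange F A B \<and> e \<notin> exchange F B A
      then \<mu> A * \<mu> B * g (exchange F A B) else 0)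
    \<le> real q ^ s * (1 - p) * (\<Sum>X | X \<subseteq> E \<and> e \<in> X. \<mu> X * g X)" (is "?L \<le> _")
proof -
  let ?swap = "\<lambda>(A, B). (exchange F A B, exchange F B A)"
  let ?G = "\<Sum>X | X \<subseteq> E \<and> e \<in> X. \<mu> X * g X"
  have "real q * ?L \<le> (\<Sum>(A, B)\<in>Pow E \<times> Pow E. if e \<in> exchange F A B \<and> e \<notin> exchange F B A
      then real q ^ s * (\<mu> (exchange F A B) * \<mu> (exchange F B A) * g (exchange F A B)) else 0)"
    unfolding sum_distrib_left
  proof (rule sum_mono)
    fix x assume "x \<in> Pow E \<times> Pow E"
    then obtain A B where x: "x = (A, B)" and AB: "A \<subseteq> E" "B \<subseteq> E" by auto
    show "real q * (case x of (A, B) \<Rightarrow> if e \<in> exchange F A B \<and> e \<notin> exchange F B A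
        then \<mu> A * \<mu> B * g (exchange F A B) else 0)
      \<le> (case x of (A, B) \<Rightarrow> if e \<in> exchange F A B \<and> e \<notin> exchange F B A
      then real q ^ s * (\<mu> (exchange F A B) * \<mu> (exchange F B A) * g (exchange F A B)) else 0)"
      using mult_right_mono[OF measure_exchange_le[OF AB cut] g[of "exchange F A B"]]
      by (simp add: x mult_ac)
  qed
  also have "\<dots> = (\<Sum>(X, Y)\<in>Pow E \<times> Pow E. if e \<in> X \<and> e \<notin> Y
      then real q ^ s * (\<mu> X * \<mu> Y * g X) else 0)"
    by (rule sum.reindex_bij_witness[of _ ?swap ?swap])
       (auto simp: exchange_exchange, auto simp: exchange_def)
  also have "\<dots> = (\<Sum>(X, Y)\<in>{X. X \<subseteq> E \<and> e \<in> X} \<times> {Y. Y \<subseteq> E \<and> e \<notin> Y}. real q ^ s * (\<mu> X * \<mu> Y * g X))"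
    using finite_E by (intro sum.mono_neutral_cong_right) (auto split: if_splits)
  also have "\<dots> = real q ^ s * (?G * (\<Sum>Y | Y \<subseteq> E \<and> e \<notin> Y. \<mu> Y))"
    by (simp add: sum_product sum_distrib_left mult_ac flip: sum.cartesian_product)
  also have "\<dots> \<le> real q ^ s * (?G * ((1 - p) * real q))"
    using g by (intro mult_left_mono measure_edge_closed_le[OF e] sum_nonneg mult_nonneg_nonneg)
      (auto simp: measure_pos less_imp_le)
  finally have "real q * ?L \<le> real q * (real q ^ s * (1 - p) * ?G)" by (simp add: mult_ac)
  then show ?thesis using q by simp
qed

text \<open>
  Canonical paths: the path from \<open>A\<close> to \<open>B\<close> adjusts the edges one after the other in the order
  of the list \<open>es\<close>; its \<open>i\<close>-th configuration is \<open>exchange (set (take i es)) A B\<close>.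
\<close>

theorem poincare_single_bond:
  assumes es: "distinct es" "set es = E"
    and cut: "\<And>i. i \<le> length es \<Longrightarrow> cut_bound (set (take i es)) s"
  shows "1 / (2 * (real (card E))\<^sup>2 * real q ^ s) * variance f \<le> dirichlet f"
proof -
  define m where "m = length es"
  have m: "card E = m" using es distinct_card by (fastforce simp: m_def)
  define X where "X i A B = exchange (set (take i es)) A B" for i A B
  define h where "h e X = (f X - f (X - {e}))\<^sup>2" for e X
  have path: "(f A - f B)\<^sup>2 \<le> real m * (\<Sum>i<m. (f (X i A B) - f (X (Suc i) A B))\<^sup>2)"
    if "A \<subseteq> E" "B \<subseteq> E" for A B
  proof -
    have "X 0 A B = A" "X m A B = B"
      using that es by (auto simp: X_def exchange_def m_def)
    then have "f A - f B = (\<Sum>i<m. f (X i A B) - f (X (Suc i) A B))"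
      using sum_lessThan_telescope'[of "\<lambda>i. f (X i A B)" m] by simp
    then show ?thesis by (simp only: sum_square_le)
  qed
  have step: "(\<Sum>(A, B)\<in>Pow E \<times> Pow E. \<mu> A * \<mu> B * (f (X i A B) - f (X (Suc i) A B))\<^sup>2)
      \<le> 2 * (real q ^ s * (1 - p) * edge_energy f (es ! i))" if i: "i < m" for i
  proof -
    let ?e = "es ! i"
    let ?c = "\<lambda>i A B. if ?e \<in> X i A B \<and> ?e \<notin> X i B A then \<mu> A * \<mu> B * h ?e (X i A B) else 0"
    have e: "?e \<in> E" "?e \<notin> set (take i es)" "set (take (Suc i) es) = insert ?e (set (take i es))"
      using i es by (auto simp: m_def take_Suc_conv_app_nth in_set_conv_nth nth_eq_iff_index_eq)
    \<comment> \<open>The \<open>i\<close>-th step changes the path only if \<open>?e\<close> lies in exactly one of \<open>A\<close> and \<open>B\<close>. Closing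
      \<open>?e\<close> is charged to the exchange before the step, opening \<open>?e\<close> to the one after it, so that
      in both cases \<open>?e\<close> is open in the first and closed in the second component.\<close>
    have "(\<Sum>(A, B)\<in>Pow E \<times> Pow E. \<mu> A * \<mu> B * (f (X i A B) - f (X (Suc i) A B))\<^sup>2)
        \<le> (\<Sum>(A, B)\<in>Pow E \<times> Pow E. ?c i A B + ?c (Suc i) A B)"
    proof (rule sum_mono, clarify)
      fix A B
      have c_nonneg: "0 \<le> ?c j A B" for j
        by (simp add: h_def measure_pos less_imp_le)
      show "\<mu> A * \<mu> B * (f (X i A B) - f (X (Suc i) A B))\<^sup>2 \<le> ?c i A B + ?c (Suc i) A B"
      proof (cases "?e \<in> A \<longleftrightarrow> ?e \<in> B")
        case True
        then have "X i A B = X (Suc i) A B" by (auto simp: X_def exchange_def e)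
        then show ?thesis using c_nonneg[of i] c_nonneg[of "Suc i"] by simp
      next
        case False
        show ?thesis
        proof (cases "?e \<in> A")
          case True
          with False have "?e \<in> X i A B" "?e \<notin> X i B A" "X (Suc i) A B = X i A B - {?e}"
            using e by (auto simp: X_def exchange_def)
          then show ?thesis using c_nonneg[of "Suc i"] by (simp add: h_def)
        next
          case notin: False
          with False have "?e \<in> X (Suc i) A B" "?e \<notin> X (Suc i) B A" "X i A B = X (Suc i) A B - {?e}"
            using e by (auto simp: X_def exchange_def)
          then show ?thesis using c_nonneg[of i] by (simp add: h_def power2_commute)
        qed
      qed
    qed
    also have "\<dots> = (\<Sum>(A, B)\<in>Pow E \<times> Pow E. ?c i A B) + (\<Sum>(A, B)\<in>Pow E \<times> Pow E. ?c (Suc i) A B)"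
      by (simp add: sum.distrib case_prod_unfold)
    also have "\<dots> \<le> real q ^ s * (1 - p) * edge_energy f ?e + real q ^ s * (1 - p) * edge_energy f ?e"
      using exchange_congestion[OF e(1) cut[of i], of "h ?e"] i
        exchange_congestion[OF e(1) cut[of "Suc i"], of "h ?e"]
      by (intro add_mono) (simp_all add: X_def m_def edge_energy_def h_def cong: if_cong)
    finally show ?thesis by (simp only: mult_2)
  qed
  have "variance f = 1 / 2 * (\<Sum>(A, B)\<in>Pow E \<times> Pow E. \<mu> A * \<mu> B * (f A - f B)\<^sup>2)"
    by (simp add: variance_def sum.cartesian_product)
  also have "\<dots> \<le> 1 / 2 * (\<Sum>(A, B)\<in>Pow E \<times> Pow E.
      \<mu> A * \<mu> B * (real m * (\<Sum>i<m. (f (X i A B) - f (X (Suc i) A B))\<^sup>2)))"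
    by (intro mult_left_mono sum_mono) (auto intro!: mult_left_mono path simp: measure_pos less_imp_le)
  also have "\<dots> = 1 / 2 * (real m * (\<Sum>i<m. \<Sum>(A, B)\<in>Pow E \<times> Pow E.
      \<mu> A * \<mu> B * (f (X i A B) - f (X (Suc i) A B))\<^sup>2))"
    by (subst sum.swap) (simp add: sum_distrib_left mult_ac case_prod_unfold)
  also have "\<dots> \<le> 1 / 2 * (real m * (\<Sum>i<m. 2 * (real q ^ s * (1 - p) * edge_energy f (es ! i))))"
    by (intro mult_left_mono sum_mono step) auto
  also have "\<dots> = real m * (real q ^ s * (1 - p) * (\<Sum>i<m. edge_energy f (es ! i)))"
    by (simp add: sum_distrib_left mult_ac)
  also have "(\<Sum>i<m. edge_energy f (es ! i)) = (\<Sum>e\<in>E. edge_energy f e)"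
    using bij_betw_nth[OF es(1) refl es(2)[symmetric]]
    by (intro sum.reindex_bij_betw) (simp add: m_def lessThan_atLeast0)
  finally have "variance f \<le> real m * (real q ^ s * (1 - p) * (\<Sum>e\<in>E. edge_energy f e))" .
  then show ?thesis
    using card_E_pos q by (simp add: dirichlet_single_bond m field_simps power2_eq_square)
qed

text \<open>
  Multiplying all weights by \<open>(1 - p) ^ card E\<close> turns the partition function into the mean of
  \<open>q\<close> to the number of components under independent percolation.
\<close>

lemma ln_inverse_measure_le:
  assumes A: "A \<subseteq> E"
  shows "ln (1 / \<mu> A) \<le> real (card E) * ln (1 / (p * (1 - p))) + real (card V) * ln (real q)"
proof -
  let ?m = "card E"
  have scaled: "(1 - p) ^ ?m * weight B = p ^ card B * (1 - p) ^ (?m - card B) * real q ^ num_components V B"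
    if "B \<subseteq> E" for B
  proof -
    have "card B \<le> ?m" using that finite_E by (rule card_mono[rotated])
    then have "(1 - p) ^ ?m = (1 - p) ^ card B * (1 - p) ^ (?m - card B)"
      by (simp flip: power_add)
    then show ?thesis using p by (simp add: rc_weight_def power_divide)
  qed
  have "(1 - p) ^ ?m * rc_partition V E p q
      \<le> (\<Sum>B\<in>Pow E. p ^ card B * (1 - p) ^ (?m - card B) * real q ^ card V)"
    unfolding rc_partition_def sum_distrib_left
    using p q num_components_le
    by (intro sum_mono) (auto simp: scaled intro!: mult_left_mono power_increasing)
  also have "\<dots> = real q ^ card V"
    using sum_Pow_bernoulli[OF finite_E, of p] by (simp flip: sum_distrib_right)
  finally have Z: "(1 - p) ^ ?m * rc_partition V E p q \<le> real q ^ card V" .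
  have "(p * (1 - p)) ^ ?m \<le> p ^ card A * (1 - p) ^ (?m - card A)"
    unfolding power_mult_distrib
  proof (rule mult_mono)
    have "card A \<le> ?m" using A finite_E by (rule card_mono[rotated])
    then show "p ^ ?m \<le> p ^ card A" using p by (intro power_decreasing) auto
    show "(1 - p) ^ ?m \<le> (1 - p) ^ (?m - card A)" using p by (intro power_decreasing) auto
  qed (use p in auto)
  also have "\<dots> \<le> (1 - p) ^ ?m * weight A"
    unfolding scaled[OF A] using p q
      mult_left_mono[of 1 "real q ^ num_components V A" "p ^ card A * (1 - p) ^ (?m - card A)"]
    by simp
  finally have w: "(p * (1 - p)) ^ ?m \<le> (1 - p) ^ ?m * weight A" .
  have "1 / \<mu> A = ((1 - p) ^ ?m * rc_partition V E p q) / ((1 - p) ^ ?m * weight A)"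
    using p by (simp add: rc_measure_def)
  also have "\<dots> \<le> real q ^ card V / (p * (1 - p)) ^ ?m"
    using p partition_pos by (intro frac_le Z w) auto
  finally have "ln (1 / \<mu> A) \<le> ln (real q ^ card V / (p * (1 - p)) ^ ?m)"
    using measure_pos[of A] by (intro ln_mono) auto
  also have "\<dots> = real ?m * ln (1 / (p * (1 - p))) + real (card V) * ln (real q)"
    using p q by (simp add: ln_div ln_realpow)
  finally show ?thesis .
qed

theorem mixing_time_single_bond_le:
  assumes es: "distinct es" "set es = E"
    and cut: "\<And>i. i \<le> length es \<Longrightarrow> cut_bound (set (take i es)) s"
    and t: "2 * (real (card E))\<^sup>2 * real q ^ s *
      (2 + real (card E) * ln (1 / (p * (1 - p))) + real (card V) * ln (real q)) \<le> real t"
  shows "mixing_time (Pow E) (single_bond V E p q) \<mu> \<le> t"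
proof (rule mixing_time_le)
  let ?C = "2 * (real (card E))\<^sup>2 * real q ^ s"
  show "1 / ?C * variance f \<le> dirichlet f" for f
    by (rule poincare_single_bond[OF es cut])
  fix A assume "A \<in> Pow E"
  then have "2 + ln (1 / \<mu> A)
      \<le> 2 + real (card E) * ln (1 / (p * (1 - p))) + real (card V) * ln (real q)"
    using ln_inverse_measure_le[of A] by simp
  also have "\<dots> \<le> 1 / ?C * real t"
    using t card_E_pos q by (simp add: field_simps)
  finally show "2 + ln (1 / \<mu> A) \<le> 1 / ?C * real t" .
qed

end


section \<open>The torus\<close>

lemma finite_torus_verts: "finite (torus_verts L d)"
  by (simp add: torus_verts_def finite_PiE)

lemma card_torus_verts: "card (torus_verts L d) = L ^ d"
  by (simp add: torus_verts_def card_PiE)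

lemma torus_edgeE:
  assumes "e \<in> torus_edges L d" "v \<in> e"
  obtains w where "e = {v, w}" "v \<in> torus_verts L d" "w \<in> torus_verts L d"
    "torus_adj L d v w \<or> torus_adj L d w v"
proof -
  obtain x y where xy: "e = {x, y}" "x \<in> torus_verts L d" "y \<in> torus_verts L d" "torus_adj L d x y"
    using assms(1) by (auto simp: torus_edges_def)
  consider "v = x" | "v = y" using assms(2) xy(1) by blast
  then show thesis
  proof cases
    case 1
    show thesis by (rule that[of y]) (use 1 xy in auto)
  next
    case 2
    show thesis by (rule that[of x]) (use 2 xy in auto)
  qed
qed

lemma finite_graph_torus: "finite_graph (torus_verts L d) (torus_edges L d)"
  by unfold_locales (auto simp: finite_torus_verts torus_edges_def)

lemma torus_edges_nonempty:
  assumes "2 \<le> L" "1 \<le> d"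
  shows "torus_edges L d \<noteq> {}"
proof -
  let ?x = "\<lambda>i\<in>{..<d}. 0 :: nat" and ?y = "\<lambda>i\<in>{..<d}. if i = 0 then 1 else 0 :: nat"
  have "?x \<in> torus_verts L d" "?y \<in> torus_verts L d"
    using assms by (auto simp: torus_verts_def)
  moreover have "torus_adj L d ?x ?y"
    unfolding torus_adj_def using assms by (intro exI[of _ 0]) auto
  ultimately have "{?x, ?y} \<in> torus_edges L d" unfolding torus_edges_def by blast
  then show ?thesis by blast
qed

text \<open>Every edge is obtained from one of its vertices by increasing one coordinate modulo \<open>L\<close>.\<close>

lemma card_torus_edges_le: "card (torus_edges L d) \<le> d * L ^ d"
proof -
  let ?h = "\<lambda>(i, x :: nat \<Rightarrow> nat). {x, x(i := (x i + 1) mod L)}"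
  have step: "y = x(i := (x i + 1) mod L)"
    if "x \<in> torus_verts L d" "y \<in> torus_verts L d" "i < d" "y i = (x i + 1) mod L"
      "\<forall>j<d. j \<noteq> i \<longrightarrow> x j = y j" for x y :: "nat \<Rightarrow> nat" and i
  proof
    fix j
    show "y j = (x(i := (x i + 1) mod L)) j"
    proof (cases "j < d")
      case True
      then show ?thesis using that(4,5) by auto
    next
      case False
      then have "x j = undefined" "y j = undefined" "j \<noteq> i"
        using that(1,2,3) by (auto simp: torus_verts_def PiE_iff extensional_def)
      then show ?thesis by simp
    qed
  qed
  have "torus_edges L d \<subseteq> ?h ` ({..<d} \<times> torus_verts L d)"
  proof
    fix e assume "e \<in> torus_edges L d"
    then obtain x y where e: "e = {x, y}" and V: "x \<in> torus_verts L d" "y \<in> torus_verts L d"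
      and "torus_adj L d x y" by (auto simp: torus_edges_def)
    then obtain i where i: "i < d" "y i = (x i + 1) mod L \<or> x i = (y i + 1) mod L"
      "\<forall>j<d. j \<noteq> i \<longrightarrow> x j = y j" by (auto simp: torus_adj_def)
    from i(2) show "e \<in> ?h ` ({..<d} \<times> torus_verts L d)"
    proof
      assume "y i = (x i + 1) mod L"
      from step[OF V i(1) this i(3)] have "e = ?h (i, x)" using e by simp
      then show ?thesis using V i by blast
    next
      assume "x i = (y i + 1) mod L"
      with step[OF V(2,1) i(1)] i(3) have "e = ?h (i, y)" using e by auto
      then show ?thesis using V i by blast
    qed
  qed
  then have "card (torus_edges L d) \<le> card (?h ` ({..<d} \<times> torus_verts L d))"
    by (intro card_mono) (auto simp: finite_torus_verts)
  also have "\<dots> \<le> card ({..<d} \<times> torus_verts L d)"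
    by (intro card_image_le) (auto simp: finite_torus_verts)
  finally show ?thesis by (simp add: card_cartesian_product card_torus_verts)
qed

text \<open>The layer of the torus at height \<open>k\<close> in the coordinate direction \<open>0\<close>.\<close>

definition torus_layer :: "nat \<Rightarrow> nat \<Rightarrow> nat \<Rightarrow> (nat \<Rightarrow> nat) set" where
  "torus_layer L d k = {x \<in> torus_verts L d. x 0 = k}"

lemma card_torus_layer_le: "card (torus_layer L d k) \<le> L ^ (d - 1)"
proof -
  have "card (torus_layer L d k) \<le> card ({1..<d} \<rightarrow>\<^sub>E {..<L})"
  proof (rule card_inj_on_le[of "\<lambda>x. restrict x {1..<d}"])
    show "inj_on (\<lambda>x. restrict x {1..<d}) (torus_layer L d k)"
    proof (rule inj_onI)
      fix x y assume xy: "x \<in> torus_layer L d k" "y \<in> torus_layer L d k"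
        and eq: "restrict x {1..<d} = restrict y {1..<d}"
      show "x = y"
      proof
        fix i
        consider "i = 0" | "1 \<le> i" "i < d" | "d \<le> i" by linarith
        then show "x i = y i"
        proof cases
          case 1
          then show ?thesis using xy by (simp add: torus_layer_def)
        next
          case 2
          then show ?thesis using fun_cong[OF eq, of i] by simp
        next
          case 3
          then show ?thesis using xy by (simp add: torus_layer_def torus_verts_def PiE_iff extensional_def)
        qed
      qed
    qed
    show "(\<lambda>x. restrict x {1..<d}) ` torus_layer L d k \<subseteq> {1..<d} \<rightarrow>\<^sub>E {..<L}"
    proof (rule image_subsetI)
      fix x assume "x \<in> torus_layer L d k"
      then have "x i \<in> {..<L}" if "i < d" for i
        using that by (simp add: torus_layer_def torus_verts_def PiE_iff)
      then show "restrict x {1..<d} \<in> {1..<d} \<rightarrow>\<^sub>E {..<L}" by simp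
    qed
    show "finite ({1..<d} \<rightarrow>\<^sub>E {..<L})" by (rule finite_PiE) simp_all
  qed
  then show ?thesis by (simp add: card_PiE)
qed

text \<open>
  Edges are ordered by their height, the larger one of the heights of their end points. An edge
  that wraps around in direction \<open>0\<close> has height \<open>L - 1\<close>.
\<close>

definition edge_height :: "(nat \<Rightarrow> nat) set \<Rightarrow> nat" where
  "edge_height e = Max ((\<lambda>x. x 0) ` e)"

lemma torus_adj_coordinate:
  assumes "torus_adj L d x y" "j < d"
  shows "x j = y j \<or> y j = (x j + 1) mod L \<or> x j = (y j + 1) mod L"
proof -
  obtain i where "y i = (x i + 1) mod L \<or> x i = (y i + 1) mod L" "\<forall>j<d. j \<noteq> i \<longrightarrow> x j = y j"
    using assms(1) by (auto simp: torus_adj_def)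
  then show ?thesis using assms(2) by (cases "j = i") auto
qed

lemma edge_height_cases:
  assumes "e \<in> torus_edges L d" "v \<in> e" "0 < v 0" "1 \<le> d"
  shows "edge_height e = v 0 \<or> edge_height e = v 0 + 1"
proof -
  obtain w where w: "e = {v, w}" "v \<in> torus_verts L d" "w \<in> torus_verts L d"
    "torus_adj L d v w \<or> torus_adj L d w v"
    using torus_edgeE[OF assms(1,2)] by blast
  have height: "edge_height e = max (v 0) (w 0)" by (simp add: edge_height_def w(1))
  have less: "v 0 < L" "w 0 < L" using w(2,3) assms(4) by (auto simp: torus_verts_def PiE_iff)
  from w(4) have "w 0 = v 0 \<or> w 0 = (v 0 + 1) mod L \<or> v 0 = (w 0 + 1) mod L"
    using torus_adj_coordinate[of L d v w 0] torus_adj_coordinate[of L d w v 0] assms(4) by auto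
  then show ?thesis
  proof (elim disjE)
    assume "w 0 = (v 0 + 1) mod L"
    then show ?thesis using less height by (cases "v 0 + 1 = L") simp_all
  next
    assume "v 0 = (w 0 + 1) mod L"
    then show ?thesis using assms(3) less height by (cases "w 0 + 1 = L") simp_all
  qed (simp add: height)
qed

text \<open>
  If no edge of \<open>F\<close> is higher than \<open>j\<close> and all other edges have at least the height \<open>j\<close>, then
  the layers \<open>0\<close>, \<open>j - 1\<close> and \<open>j\<close> separate \<open>F\<close> from the other edges. Layer \<open>0\<close> is needed because
  of the edges that wrap around.
\<close>

lemma torus_cut:
  assumes e: "e \<in> torus_edges L d" "edge_height e \<le> j" and f: "f \<in> torus_edges L d" "j \<le> edge_height f"
    and v: "v \<in> e" "v \<in> f" and d: "1 \<le> d"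
  shows "v \<in> torus_layer L d 0 \<union> torus_layer L d (j - 1) \<union> torus_layer L d j"
proof -
  have V: "v \<in> torus_verts L d" using torus_edgeE[OF e(1) v(1)] by blast
  show ?thesis
  proof (cases "v 0 = 0")
    case False
    then have "v 0 = j \<or> v 0 = j - 1"
      using edge_height_cases[OF e(1) v(1) _ d] edge_height_cases[OF f(1) v(2) _ d] e(2) f(2) by linarith
    then show ?thesis using V by (auto simp: torus_layer_def)
  qed (use V in \<open>auto simp: torus_layer_def\<close>)
qed

text \<open>
  In the order of increasing height, every initial segment of the edges is separated from the
  rest by at most three layers.
\<close>

lemma torus_edge_order:
  assumes "1 \<le> L" "1 \<le> d"
  obtains es where "distinct es" "set es = torus_edges L d"
    "\<And>i. i \<le> length es \<Longrightarrow>
      finite_graph.cut_bound (torus_verts L d) (torus_edges L d) (set (take i es)) (3 * L ^ (d - 1))"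
proof -
  interpret finite_graph "torus_verts L d" "torus_edges L d"
    by (rule finite_graph_torus)
  let ?E = "torus_edges L d"
  obtain xs where xs: "distinct xs" "set xs = ?E"
    using finite_distinct_list[OF finite_E] by blast
  define es where "es = sort_key edge_height xs"
  have es: "distinct es" "set es = ?E" using xs by (simp_all add: es_def)
  have sorted: "edge_height (es ! i) \<le> edge_height (es ! k)" if "i \<le> k" "k < length es" for i k
    using sorted_nth_mono[of "map edge_height es" i k] that by (simp add: es_def)
  show thesis
  proof (rule that[OF es])
    fix i assume i: "i \<le> length es"
    \<comment> \<open>If all edges precede position \<open>i\<close>, nothing is to be separated and \<open>j\<close> is arbitrary.\<close>
    define j where "j = (if i < length es then edge_height (es ! i) else 0)"
    let ?T = "torus_layer L d 0 \<union> torus_layer L d (j - 1) \<union> torus_layer L d j"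
    have "?T \<subseteq> torus_verts L d" by (auto simp: torus_layer_def)
    moreover have "?T \<noteq> {}"
    proof -
      have "(\<lambda>i\<in>{..<d}. 0) \<in> torus_layer L d 0"
        using assms by (auto simp: torus_layer_def torus_verts_def)
      then show ?thesis by blast
    qed
    moreover have "card ?T \<le> 3 * L ^ (d - 1)"
      using card_Un_le[of "torus_layer L d 0 \<union> torus_layer L d (j - 1)" "torus_layer L d j"]
        card_Un_le[of "torus_layer L d 0" "torus_layer L d (j - 1)"]
        card_torus_layer_le[of L d 0] card_torus_layer_le[of L d "j - 1"] card_torus_layer_le[of L d j]
      by linarith
    moreover have "f \<inter> e \<subseteq> ?T" if f: "f \<in> set (take i es) \<inter> ?E" and e: "e \<in> ?E - set (take i es)" for f e
    proof -
      have i_less: "i < length es" using e es(2) i by (cases "i = length es") auto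
      obtain a where a: "a < i" "f = es ! a" using f by (auto simp: in_set_conv_nth)
      obtain b where b: "b < length es" "e = es ! b" using e es(2) by (metis DiffE in_set_conv_nth)
      have "i \<le> b"
      proof (rule ccontr)
        assume "\<not> i \<le> b"
        then have "e \<in> set (take i es)" using b by (auto simp: in_set_conv_nth)
        then show False using e by blast
      qed
      then have "edge_height f \<le> j" "j \<le> edge_height e"
        using sorted[of a i] sorted[of i b] a b i_less by (auto simp: j_def)
      then show ?thesis using torus_cut[of f L d j e] f e assms(2) by blast
    qed
    ultimately show "cut_bound (set (take i es)) (3 * L ^ (d - 1))"
      unfolding cut_bound_def by (intro exI[of _ ?T]) blast
  qed
qed

lemma dimension_times_side_le:
  assumes "2 \<le> L" "2 \<le> d"
  shows "d * L \<le> 2 * L ^ (d - 1)"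
  using assms(2)
proof (induction d rule: dec_induct)
  case (step d)
  have "Suc d \<le> L * d" using mult_le_mono1[OF assms(1), of d] step.hyps by linarith
  then have "Suc d * L \<le> L * (d * L)" by (simp only: mult.assoc[symmetric] mult_le_mono1)
  also have "\<dots> \<le> L * (2 * L ^ (d - 1))" using step.IH by (rule mult_le_mono2)
  also have "\<dots> = 2 * L ^ (Suc d - 1)" using step.hyps by (cases d) auto
  finally show ?case .
qed simp


section \<open>Collecting the constants\<close>

lemma polynomial_le_exp:
  assumes "2 \<le> n"
  shows "1 + 16 * real n ^ 6 \<le> exp (4 * real n)"
proof -
  have "(1::real) + 1 + 1\<^sup>2 / 2 \<le> exp 1" by (rule exp_lower_Taylor_quadratic) simp
  then have "(5 / 2 :: real) ^ 4 \<le> exp 1 ^ (4::nat)" by (intro power_mono) auto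
  then have base: "(39::real) \<le> exp 4"
    by (simp add: power_divide flip: exp_of_nat_mult)
  have "1 + 16 * real n ^ 6 \<le> 39 ^ n" using assms
  proof (induction n rule: dec_induct)
    case (step n)
    have arith: "1 + 16 * y \<le> 39 * (1 + 16 * x)" if "y \<le> 729 / 64 * x" "0 \<le> x" for x y :: real
      using that by simp
    have "real (Suc n) ^ 6 \<le> (3 / 2 * real n) ^ 6" using step.hyps by (intro power_mono) auto
    also have "\<dots> = 729 / 64 * real n ^ 6" by (simp add: power_mult_distrib power_divide)
    finally have "1 + 16 * real (Suc n) ^ 6 \<le> 39 * (1 + 16 * real n ^ 6)"
      by (intro arith) auto
    also have "\<dots> \<le> 39 * 39 ^ n" using step.IH by simp
    finally show ?case by simp
  qed simp
  also have "\<dots> \<le> exp 4 ^ n" using base by (intro power_mono) auto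
  also have "\<dots> = exp (4 * real n)" by (simp add: mult.commute flip: exp_of_nat_mult)
  finally show ?thesis .
qed

text \<open>
  Here \<open>n\<close> stands for \<open>L ^ (d - 1)\<close>, and \<open>m\<close> and \<open>v\<close> for the numbers of edges and vertices. The
  summand \<open>1\<close> on the left is for rounding up to an integer.
\<close>

lemma collect_constants:
  fixes p :: real
  assumes p: "0 < p" "p < 1" and q: "1 \<le> q" and n: "2 \<le> n"
    and m: "m \<le> 2 * n\<^sup>2" and v: "v \<le> n\<^sup>2"
  shows "2 * (real m)\<^sup>2 * real q ^ (3 * n) *
      (2 + real m * ln (1 / (p * (1 - p))) + real v * ln (real q)) + 1
    \<le> exp (k1 p + k2 q * real n)"
proof -
  define l where "l = ln (1 / (p * (1 - p)))"
  define k where "k = ln (real q)"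
  have "p * (1 - p) \<le> 1 * 1" using p by (intro mult_mono) auto
  then have l: "0 \<le> l" using p by (simp add: l_def ln_div)
  have k: "0 \<le> k" using q by (simp add: k_def)
  have m': "real m \<le> 2 * real n ^ 2" "real v \<le> real n ^ 2"
    using m v by (metis of_nat_le_iff of_nat_mult of_nat_numeral of_nat_power)+
  have n1: "1 \<le> real n ^ 2" using n by simp
  have "2 + real m * l + real v * k \<le> 2 * real n ^ 2 + 2 * real n ^ 2 * l + 2 * real n ^ 2 * k"
    using mult_right_mono[OF m'(1) l] mult_right_mono[OF m'(2) k] mult_right_mono[OF n1 k] n1 k
    by linarith
  also have "\<dots> \<le> 2 * real n ^ 2 * ((1 + l) * (1 + k))"
    using l k by (simp add: algebra_simps)
  finally have bracket: "2 + real m * l + real v * k \<le> 2 * real n ^ 2 * ((1 + l) * (1 + k))" .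
  have "2 * (real m)\<^sup>2 * real q ^ (3 * n) * (2 + real m * l + real v * k) + 1
      \<le> 2 * (2 * real n ^ 2)\<^sup>2 * real q ^ (3 * n) * (2 * real n ^ 2 * ((1 + l) * (1 + k))) + 1"
    using m' l k by (intro add_right_mono mult_mono bracket power_mono) auto
  also have "\<dots> = 16 * real n ^ 6 * (real q ^ (3 * n) * ((1 + l) * (1 + k))) + 1"
    by (simp add: power_mult_distrib flip: power_mult power_add)
  also have "\<dots> \<le> 16 * real n ^ 6 * (real q ^ (3 * n) * ((1 + l) * (1 + k)))
      + 1 * (real q ^ (3 * n) * ((1 + l) * (1 + k)))"
  proof -
    have "1 * (1 * 1) \<le> real q ^ (3 * n) * ((1 + l) * (1 + k))"
      using q l k by (intro mult_mono) (auto intro: one_le_power)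
    then show ?thesis by simp
  qed
  also have "\<dots> = (1 + 16 * real n ^ 6) * (real q ^ (3 * n) * ((1 + l) * (1 + k)))"
    by (simp add: algebra_simps)
  also have "\<dots> \<le> exp (4 * real n) * (real q ^ (3 * n) * ((1 + l) * (1 + k) ^ n))"
  proof (intro mult_mono polynomial_le_exp n order.refl)
    show "1 + k \<le> (1 + k) ^ n"
      using power_increasing[of 1 n "1 + k"] n k by simp
  qed (use l k in auto)
  also have "\<dots> = exp (4 * real n) * (exp (3 * real n * k) * (exp (ln (1 + l)) * exp (real n * ln (1 + k))))"
  proof -
    have "real q ^ (3 * n) = exp (3 * real n * k)"
      using q by (simp add: k_def exp_of_nat_mult[of "3 * n", simplified])
    moreover have "(1 + k) ^ n = exp (real n * ln (1 + k))"
      using k by (simp add: exp_of_nat_mult)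
    ultimately show ?thesis using l by simp
  qed
  also have "\<dots> = exp (k1 p + k2 q * real n)"
    by (simp add: k1_def k2_def l_def k_def algebra_simps flip: exp_add)
  finally show ?thesis by (simp add: l_def k_def)
qed

theorem theorem11:
  fixes p :: real and q L d :: nat
  assumes "0 < p" and "p < 1"
    and "q \<ge> 1"
    and "L \<ge> 2" and "d \<ge> 2"
  shows "real (mixing_time (Pow (torus_edges L d))
                 (single_bond (torus_verts L d) (torus_edges L d) p q)
                 (rc_measure (torus_verts L d) (torus_edges L d) p q))
         \<le> exp (k1 p + k2 q * real L ^ (d - 1))"
proof -
  define n where "n = L ^ (d - 1)"
  define m where "m = card (torus_edges L d)"
  define C where "C = 2 * (real m)\<^sup>2 * real q ^ (3 * n) *
      (2 + real m * ln (1 / (p * (1 - p))) + real (card (torus_verts L d)) * ln (real q))"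
  interpret finite_graph "torus_verts L d" "torus_edges L d"
    by (rule finite_graph_torus)
  interpret random_cluster "torus_verts L d" "torus_edges L d" p q
    using assms torus_edges_nonempty[of L d] by unfold_locales auto
  obtain es where es: "distinct es" "set es = torus_edges L d"
    and cut: "\<And>i. i \<le> length es \<Longrightarrow> cut_bound (set (take i es)) (3 * n)"
    unfolding n_def by (rule torus_edge_order[of L d]) (use assms in auto)
  have Ld: "L ^ d = L * n" using assms(5) by (cases d) (auto simp: n_def)
  \<comment> \<open>This uses \<open>d \<ge> 2\<close>, and so does the bound on the number of edges.\<close>
  have L_le: "L \<le> n" using power_increasing[of 1 "d - 1" L] assms by (simp add: n_def)
  have "C + 1 \<le> exp (k1 p + k2 q * real n)"
    unfolding C_def
  proof (rule collect_constants[OF assms(1-3)])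
    show "2 \<le> n" using L_le assms by simp
    have "m \<le> d * L * n" using card_torus_edges_le[of L d] by (simp add: m_def Ld mult.assoc)
    also have "\<dots> \<le> 2 * n * n"
      using dimension_times_side_le[OF assms(4,5)] by (intro mult_le_mono1) (simp add: n_def)
    finally show "m \<le> 2 * n\<^sup>2" by (simp add: power2_eq_square)
    show "card (torus_verts L d) \<le> n\<^sup>2"
      using L_le by (simp add: card_torus_verts Ld power2_eq_square)
  qed
  moreover have "mixing_time (Pow (torus_edges L d))
      (single_bond (torus_verts L d) (torus_edges L d) p q)
      (rc_measure (torus_verts L d) (torus_edges L d) p q) \<le> nat \<lceil>C\<rceil>" (is "?\<tau> \<le> _")
    by (rule mixing_time_single_bond_le[OF es cut]) (auto simp: C_def m_def real_nat_ceiling_ge)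
  then have "real ?\<tau> \<le> real (nat \<lceil>C\<rceil>)" by simp
  moreover have "0 \<le> C"
  proof -
    have "p * (1 - p) \<le> 1 * 1" using assms by (intro mult_mono) auto
    then show ?thesis using assms by (auto simp: C_def intro!: mult_nonneg_nonneg add_nonneg_nonneg ln_ge_zero)
  qed
  then have "real (nat \<lceil>C\<rceil>) \<le> C + 1" by linarith
  ultimately show ?thesis by (simp add: n_def)
qed

end
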